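(* Suppose that $\Theta=(\theta_m)_{m\in\mathbb{N}}$ satisfies the standing assumptions (A) stated in the context (with the integer $k\ge1$ appearing there) and that $\mathfrak{S}_n$ is endowed with $\mathbb{P}_\Theta$. Let $K_{0n}:=\sum_{m=1}^n C_m$ be the total number of cycles. Then, as $n\to\infty$, $$\frac{K_{0n}-\mathbb{E}[K_{0n}]}{\sqrt{\frac{\log^{k+1}(n)}{k+1}}}\stackrel{d}{\longrightarrow}\mathcal{N}(0,1),$$ where $\mathcal{N}(0,1)$ is the standard normal distribution, and $$\mathbb{E}[K_{0n}]\sim\frac{\log^{k+1}(n)}{k+1}.$$
   Context: $\mathfrak{S}_n$ is the symmetric group on $\{1,\dots,n\}$, and for $\sigma\in\mathfrak{S}_n$, $C_m=C_m(\sigma)$ is the number of cycles of length $m$ in the cycle decomposition of $\sigma$. For $\Theta=(\theta_m)_{m\ge1}$ with $\theta_m\ge 0$, the probability measure $\mathbb{P}_\Theta$ on $\mathfrak{S}_n$ is $\mathbb{P}_\Theta[\sigma]=\frac{1}{h_n n!}\prod_{m=1}^n\theta_m^{C_m(\sigma)}$, with $h_n=h_n(\Theta)$ the normalization constant and $h_0:=1$. Expectations are with respect to $\mathbb{P}_\Theta$. Put $g_\Theta(t)=\sum_{m\ge1}\frac{\theta_m}{m}t^m$. Also $\log^{a}(n)=(\log n)^a$. Standing assumptions (A): $\theta_m\ge0$ for all $m\ge 1$; $g_\Theta$ is holomorphic for $|t|<1$; $g_\Theta$ is continuous (extends continuously) in the punctured disc $\{|t|\le1,\ t\ne1\}$;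 and there exist an integer $k\ge1$ and a polynomial $P(r)=\frac{r^{k+1}}{k+1}+\sum_{j=0}^k c_jr^j$ with real $c_j$ such that $g_\Theta(e^{-w})=P(-\log w)+O(w)$ as $w\to0$, $\mathrm{Re}(w)\ge0$ (principal branch of $\log$). *)

theory Defs
  imports "HOL-Probability.Probability" "HOL-Combinatorics.Combinatorics"
    "HOL-Complex_Analysis.Complex_Analysis" "HOL-Library.Landau_Symbols"
begin

text \<open>
  The symmetric group on \<open>{1..n}\<close> is \<open>{\<sigma>. \<sigma> permutes {1..n}}\<close>. The cycles of \<open>\<sigma>\<close> are identified
  with their supports, i.e. the orbits of \<open>\<sigma>\<close> on \<open>{1..n}\<close>. Fixed points are cycles of length 1.
  The degree \<open>n\<close> is an explicit argument because \<open>\<sigma>\<close>, as a function on all naturals, does not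
  determine it.
\<close>

definition num_cycles_of_length :: "nat \<Rightarrow> nat \<Rightarrow> (nat \<Rightarrow> nat) \<Rightarrow> nat" where
  "num_cycles_of_length n m \<sigma> = card {c \<in> orbit \<sigma> ` {1..n}. card c = m}"

definition cycle_weight :: "(nat \<Rightarrow> real) \<Rightarrow> nat \<Rightarrow> (nat \<Rightarrow> nat) \<Rightarrow> real" where
  "cycle_weight \<theta> n \<sigma> = (\<Prod>m=1..n. \<theta> m ^ num_cycles_of_length n m \<sigma>)"

definition weight_norm :: "(nat \<Rightarrow> real) \<Rightarrow> nat \<Rightarrow> real" where
  "weight_norm \<theta> n = (\<Sum>\<sigma> | \<sigma> permutes {1..n}. cycle_weight \<theta> n \<sigma>) / fact n"

text \<open>
  For those \<open>n\<close> with \<open>weight_norm \<theta> n = 0\<close>, where the probability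
  measure does not exist, this is the zero measure.
\<close>

definition weighted_perm_measure :: "(nat \<Rightarrow> real) \<Rightarrow> nat \<Rightarrow> (nat \<Rightarrow> nat) measure" where
  "weighted_perm_measure \<theta> n =
     point_measure {\<sigma>. \<sigma> permutes {1..n}}
       (\<lambda>\<sigma>. ennreal (cycle_weight \<theta> n \<sigma> / (weight_norm \<theta> n * fact n)))"

lemma weight_norm_0: "weight_norm \<theta> 0 = 1"
  by (simp add: weight_norm_def cycle_weight_def)

lemma prob_space_weighted_perm_measure:
  assumes nonneg: "\<And>m. 1 \<le> m \<Longrightarrow> 0 \<le> \<theta> m" and nz: "weight_norm \<theta> n \<noteq> 0"
  shows "prob_space (weighted_perm_measure \<theta> n)"
proof -
  let ?S = "{\<sigma>. \<sigma> permutes {1..n}}"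
  have fin: "finite ?S" by (simp add: finite_permutations)
  have w: "0 \<le> cycle_weight \<theta> n \<sigma>" for \<sigma>
    unfolding cycle_weight_def using nonneg by (intro prod_nonneg) auto
  hence h: "0 \<le> weight_norm \<theta> n"
    unfolding weight_norm_def by (intro divide_nonneg_nonneg sum_nonneg) auto
  have "(\<Sum>\<sigma>\<in>?S. cycle_weight \<theta> n \<sigma> / (weight_norm \<theta> n * fact n)) = 1"
    using nz by (simp add: sum_divide_distrib [symmetric])
      (simp add: weight_norm_def)
  moreover have "emeasure (weighted_perm_measure \<theta> n) ?S =
      (\<Sum>\<sigma>\<in>?S. ennreal (cycle_weight \<theta> n \<sigma> / (weight_norm \<theta> n * fact n)))"
    unfolding weighted_perm_measure_def by (rule emeasure_point_measure_finite) (use fin in auto)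
  moreover have "\<dots> = ennreal (\<Sum>\<sigma>\<in>?S. cycle_weight \<theta> n \<sigma> / (weight_norm \<theta> n * fact n))"
    using w h by (intro sum_ennreal) auto
  ultimately have "emeasure (weighted_perm_measure \<theta> n) ?S = 1" by simp
  thus ?thesis
    by (intro prob_spaceI) (simp add: weighted_perm_measure_def space_point_measure)
qed

definition total_cycles :: "nat \<Rightarrow> (nat \<Rightarrow> nat) \<Rightarrow> nat" where
  "total_cycles n \<sigma> = (\<Sum>m=1..n. num_cycles_of_length n m \<sigma>)"

definition expected_total_cycles :: "(nat \<Rightarrow> real) \<Rightarrow> nat \<Rightarrow> real" where
  "expected_total_cycles \<theta> n =
     integral\<^sup>L (weighted_perm_measure \<theta> n) (\<lambda>\<sigma>. real (total_cycles n \<sigma>))"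

text \<open>The summation index is shifted by one; the value \<open>\<theta> 0\<close> is never used.\<close>

definition g_theta :: "(nat \<Rightarrow> real) \<Rightarrow> complex \<Rightarrow> complex" where
  "g_theta \<theta> t = (\<Sum>i. complex_of_real (\<theta> (Suc i) / real (Suc i)) * t ^ Suc i)"

text \<open>
  Convergence of the power series is required separately, since \<open>suminf\<close> is total. The function
  \<open>G\<close> is the (unique) continuous extension of \<open>g_theta \<theta>\<close> to the closed unit disc without 1; the
  asymptotic expansion involves its boundary values when \<open>Re w = 0\<close>. The filter
  \<open>at 0 within {w. 0 \<le> Re w}\<close> excludes \<open>w = 0\<close>.
\<close>

definition standing_assumptions :: "(nat \<Rightarrow> real) \<Rightarrow> nat \<Rightarrow> bool" where
  "standing_assumptions \<theta> k \<longleftrightarrow>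
     (\<forall>m\<ge>1. 0 \<le> \<theta> m) \<and>
     (\<forall>t\<in>ball 0 1. summable (\<lambda>i. complex_of_real (\<theta> (Suc i) / real (Suc i)) * t ^ Suc i)) \<and>
     g_theta \<theta> holomorphic_on ball 0 1 \<and>
     1 \<le> k \<and>
     (\<exists>(G :: complex \<Rightarrow> complex) (c :: nat \<Rightarrow> real).
        continuous_on (cball 0 1 - {1}) G \<and>
        (\<forall>t\<in>ball 0 1. G t = g_theta \<theta> t) \<and>
        (let P = (\<lambda>r :: complex. r ^ (k + 1) / of_nat (k + 1) + (\<Sum>j=0..k. of_real (c j) * r ^ j))
         in (\<lambda>w. G (exp (- w)) - P (- Ln w)) \<in> O[at 0 within {w. 0 \<le> Re w}](\<lambda>w. w)))"

end

theory Submission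
  imports Defs "HOL-Real_Asymp.Real_Asymp"
begin

text \<open>
  By the cycle index recursion, the generating function of the number of cycles is
  \<open>E u^K = [t^n] exp (u g(t)) / [t^n] exp (g(t))\<close>. Both coefficients are Cauchy integrals over the same
  circle \<open>\<bar>t\<bar> = exp (- exp (-r))\<close>, where \<open>r\<close> solves the saddle point equation \<open>exp r * P' r = n\<close> for \<open>u = 1\<close>.
  For \<open>u = exp (s / \<sigma>)\<close> with \<open>\<sigma>\<^sup>2 = log^(k+1) n / (k+1)\<close> the saddle point moves by less than the width of the
  peak, so after division by \<open>exp (u P r)\<close> both integrals converge to the same Gaussian integral. Hence
  \<open>E exp (s (K - P r) / \<sigma>)\<close> tends to \<open>exp (s\<^sup>2 / 2)\<close> for every complex \<open>s\<close>: real \<open>s\<close> give \<open>E K = P r + o(\<sigma>)\<close>,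
  and imaginary \<open>s\<close> give the limit law by Levy's continuity theorem.
\<close>

section \<open>The cycle index of the symmetric group\<close>

text \<open>Centring at \<open>log^(k+1) n / (k+1)\<close> would fail: \<open>r\<close> differs from
  \<open>log n\<close> by about \<open>k log log n\<close>, which moves the polynomial by order
  \<open>r^k log r\<close>, more than \<open>\<sigma>\<close>. Hence the exponential moments are
  centred at \<open>P r\<close>, and they themselves have to identify the mean. The scales: for
  \<open>w = exp (- r) * (1 + iv)\<close> the exponent \<open>P (- Ln w) + n * w\<close> is, to
  second order in \<open>v\<close>, a constant minus \<open>Q r * v^2 / 2\<close>, where
  \<open>Q = P'\<close>. So the peak has width \<open>r^(-k/2)\<close>. Replacing 1 by
  \<open>u\<close> shifts the saddle point by a relative amount of order \<open>|u - 1|\<close>,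
  that is \<open>r^(-(k+1)/2)\<close>, smaller than the width by a factor \<open>r^(-1/2)\<close>.
  What remains is the behaviour of a Poisson variable with parameter \<open>P r\<close>, whose
  variance is asymptotic to \<open>\<sigma>^2\<close>. Two things need uniform control. A complex
  \<open>u\<close> disturbs the decay of \<open>exp (u * P)\<close> off the real axis, so the decay
  must absorb the disturbance at every \<open>v\<close>. And away from \<open>t = 1\<close> nothing
  but continuity of \<open>G\<close> is available; a constant bound suffices there, because
  \<open>k \<ge> 1\<close> makes \<open>exp (P r)\<close> outgrow every power of
  \<open>n\<close>.\<close>

lemma orbit_transpose_comp_avoiding:
  assumes "finite S" "p permutes S" "a \<notin> S" "x \<in> S" "x \<notin> orbit p b"
  shows "orbit (Transposition.transpose a b \<circ> p) x = orbit p x"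
proof (rule orbit_cong)
  have perm: "permutation p" using assms by (auto simp: permutation_permutes)
  show xx: "x \<in> orbit p x" by (rule permutation_self_in_orbit[OF perm])
  fix s assume s: "s \<in> orbit p x"
  have ps: "p s \<in> orbit p x" using s by (rule orbit.step)
  have "p s \<noteq> a" using permutes_orbit_subset[OF assms(2,4)] ps assms(3) by auto
  moreover have "p s \<noteq> b" using orbit_swap[OF xx ps] assms(5) by auto
  ultimately show "(Transposition.transpose a b \<circ> p) s = p s" by (simp add: transpose_def)
qed

text \<open>Composition with the transposition puts \<open>a\<close> into the cycle of
  \<open>b\<close>, directly before \<open>b\<close>: the old predecessor of \<open>b\<close> is
  sent to \<open>a\<close>, and \<open>a\<close>, which \<open>p\<close> fixes, is sent to
  \<open>b\<close>.\<close>

lemma orbit_transpose_comp_new: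
  assumes "finite S" "p permutes S" "a \<notin> S" "b \<in> S"
  shows "orbit (Transposition.transpose a b \<circ> p) a = insert a (orbit p b)"
proof -
  let ?q = "Transposition.transpose a b \<circ> p"
  have pa: "p a = a" using assms(2,3) by (auto simp: permutes_def)
  have qa: "?q a = b" by (simp add: pa)
  have "p permutes insert a S" using assms(2) by (rule permutes_subset) auto
  hence "?q permutes insert a S"
    using assms by (intro permutes_compose permutes_swap_id) auto
  hence "permutation ?q" using assms(1) by (auto simp: permutation_permutes)
  hence aa: "a \<in> orbit ?q a" by (rule permutation_self_in_orbit)
  have "permutation p" using assms by (auto simp: permutation_permutes)
  hence bb: "b \<in> orbit p b" by (rule permutation_self_in_orbit)
  have sub: "orbit p b \<subseteq> S" by (rule permutes_orbit_subset[OF assms(2,4)])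
  show ?thesis
  proof (intro equalityI subsetI)
    fix y assume "y \<in> orbit ?q a"
    then show "y \<in> insert a (orbit p b)"
    proof induction
      case base
      then show ?case using bb qa by simp
    next
      case (step y)
      then consider "y = a" | "y \<in> orbit p b" by auto
      then show ?case
      proof cases
        case 1
        then show ?thesis using bb qa by simp
      next
        case 2
        hence py: "p y \<in> orbit p b" by (rule orbit.step)
        moreover have "p y \<noteq> a" using py sub assms(3) by auto
        ultimately show ?thesis by (auto simp: Transposition.transpose_def)
      qed
    qed
  next
    have b_in: "b \<in> orbit ?q a" using orbit.base[of ?q a] qa by simp
    have stp: "p y \<in> orbit ?q a" if "y \<in> orbit p b" "y \<in> orbit ?q a" for y
    proof -
      have "p y \<noteq> a" using orbit.step[OF that(1)] sub assms(3) by auto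
      hence "p y = b \<or> p y = ?q y" by (auto simp: Transposition.transpose_def)
      thus ?thesis using b_in orbit.step[OF that(2)] by auto
    qed
    fix y assume "y \<in> insert a (orbit p b)"
    then consider "y = a" | "y \<in> orbit p b" by auto
    then show "y \<in> orbit ?q a"
    proof cases
      case 2
      then show ?thesis
        by (induction rule: orbit.induct) (use stp b_in bb in blast)+
    qed (use aa in simp)
  qed
qed

lemma card_orbit_transpose_comp_new:
  assumes "finite S" "p permutes S" "a \<notin> S" "b \<in> S"
  shows "card (orbit (Transposition.transpose a b \<circ> p) a) = Suc (card (orbit p b))"
proof -
  have sub: "orbit p b \<subseteq> S" by (rule permutes_orbit_subset[OF assms(2,4)])
  thus ?thesis
    unfolding orbit_transpose_comp_new[OF assms]
    using assms(1,3) finite_subset by (subst card_insert_disjoint) auto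
qed

text \<open>The enlarged cycle is the only one that changes, so a product over the cycles other than
  the one through the new point is inherited from \<open>p\<close>.\<close>

lemma orbits_transpose_comp:
  assumes "finite S" "p permutes S" "a \<notin> S" "b \<in> S"
  shows "orbit (Transposition.transpose a b \<circ> p) ` insert a S - {orbit (Transposition.transpose a b \<circ> p) a}
       = orbit p ` S - {orbit p b}"
proof -
  let ?q = "Transposition.transpose a b \<circ> p"
  have "p permutes insert a S" using assms(2) by (rule permutes_subset) auto
  hence "?q permutes insert a S"
    using assms by (intro permutes_compose permutes_swap_id) auto
  hence cyc: "cyclic_on ?q (orbit ?q a)" using assms(1) by (intro cyclic_on_orbit[where S="insert a S"]) auto
  have cycb: "cyclic_on p (orbit p b)" using assms by (intro cyclic_on_orbit) auto
  have pp: "permutation p" using assms by (auto simp: permutation_permutes)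
  have 1: "orbit ?q x = orbit ?q a" if "x \<in> orbit p b" for x
    using that by (intro orbit_cyclic_eq3[OF cyc]) (simp add: orbit_transpose_comp_new[OF assms])
  have 2: "orbit ?q x = orbit p x" if "x \<in> S" "x \<notin> orbit p b" for x
    using assms that by (intro orbit_transpose_comp_avoiding) auto
  have 3: "orbit p x = orbit p b" if "x \<in> orbit p b" for x
    using that by (intro orbit_cyclic_eq3[OF cycb])
  have 4: "orbit p x \<noteq> orbit p b" if "x \<notin> orbit p b" for x
    using that permutation_self_in_orbit[OF pp, of x] by auto
  have 5: "orbit ?q a \<noteq> orbit p x" if "x \<in> S" for x
    using permutes_orbit_subset[OF assms(2) that] assms(3)
    by (auto simp: orbit_transpose_comp_new[OF assms])
  show ?thesis
  proof (intro equalityI subsetI)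
    fix c assume "c \<in> orbit ?q ` insert a S - {orbit ?q a}"
    then obtain x where x: "x \<in> S" "c = orbit ?q x" "c \<noteq> orbit ?q a" by auto
    hence "x \<notin> orbit p b" using 1 by auto
    thus "c \<in> orbit p ` S - {orbit p b}" using x 2 4 by auto
  next
    fix c assume "c \<in> orbit p ` S - {orbit p b}"
    then obtain x where x: "x \<in> S" "c = orbit p x" "c \<noteq> orbit p b" by auto
    hence "x \<notin> orbit p b" using 3 by auto
    hence "c = orbit ?q x" using 2 x by auto
    thus "c \<in> orbit ?q ` insert a S - {orbit ?q a}" using x 5 by auto
  qed
qed

text \<open>A product over cycles rather than over lengths, so that a single cycle can be split
  off.\<close>

definition orbit_weight :: "(nat \<Rightarrow> 'b :: comm_monoid_mult) \<Rightarrow> 'a set \<Rightarrow> ('a \<Rightarrow> 'a) \<Rightarrow> 'b" where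
  "orbit_weight a S p = (\<Prod>c\<in>orbit p ` S. a (card c))"

text \<open>
  The cycle through the marked point \<open>x\<close> carries its own weight function \<open>f\<close>. Removing \<open>x\<close> from
  that cycle moves the mark to its successor and replaces \<open>f\<close> by \<open>f \<circ> Suc\<close>.
\<close>
definition marked_sum :: "(nat \<Rightarrow> 'b :: comm_semiring_1) \<Rightarrow> (nat \<Rightarrow> 'b) \<Rightarrow> 'a set \<Rightarrow> 'a \<Rightarrow> 'b" where
  "marked_sum a f S x = (\<Sum>p | p permutes S. f (card (orbit p x)) *
     (\<Prod>c\<in>orbit p ` S - {orbit p x}. a (card c)))"

text \<open>Each permutation of \<open>insert x S\<close> is \<open>transpose x b \<circ> q\<close>
  for a unique \<open>b\<close> and a unique \<open>q\<close> permuting \<open>S\<close>. The choice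
  \<open>b = x\<close> makes \<open>x\<close> a fixed point; any other \<open>b\<close> has
  \<open>x\<close> put before it, and its cycle takes over the mark.\<close>

lemma marked_sum_insert:
  fixes S :: "'a set"
  assumes "finite S" "x \<notin> S"
  shows "marked_sum a f (insert x S) x =
    f 1 * (\<Sum>p | p permutes S. orbit_weight a S p) + (\<Sum>y\<in>S. marked_sum a (f \<circ> Suc) S y)"
proof -
  define F where "F = (\<lambda>p. f (card (orbit p x)) *
     (\<Prod>c\<in>orbit p ` insert x S - {orbit p x}. a (card c)))"
  have "marked_sum a f (insert x S) x =
     (\<Sum>b\<in>insert x S. \<Sum>q | q permutes S. F (Transposition.transpose x b \<circ> q))"
    unfolding marked_sum_def F_def[symmetric] using assms
    by (rule sum_over_permutations_insert)
  also have "\<dots> = (\<Sum>q | q permutes S. F q) + (\<Sum>b\<in>S. \<Sum>q | q permutes S. F (Transposition.transpose x b \<circ> q))"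
    using assms by simp
  also have "(\<Sum>q | q permutes S. F q) = f 1 * (\<Sum>p | p permutes S. orbit_weight a S p)"
    unfolding sum_distrib_left
  proof (intro sum.cong refl)
    fix q assume "q \<in> {q. q permutes S}"
    hence q: "q permutes S" by simp
    have "q x = x" using q assms by (auto simp: permutes_def)
    hence ox: "orbit q x = {x}" by (simp add: orbit_eq_singleton_iff)
    have "{x} \<notin> orbit q ` S"
      using permutes_orbit_subset[OF q] assms by fastforce
    hence "orbit q ` insert x S - {orbit q x} = orbit q ` S" by (auto simp: ox)
    thus "F q = f 1 * orbit_weight a S q"
      by (simp add: F_def orbit_weight_def ox)
  qed
  also have "(\<Sum>b\<in>S. \<Sum>q | q permutes S. F (Transposition.transpose x b \<circ> q)) = (\<Sum>y\<in>S. marked_sum a (f \<circ> Suc) S y)"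
    unfolding marked_sum_def
  proof (intro sum.cong refl)
    fix b q assume "b \<in> S" "q \<in> {q. q permutes S}"
    with assms show "F (Transposition.transpose x b \<circ> q) = (f \<circ> Suc) (card (orbit q b)) *
          (\<Prod>c\<in>orbit q ` S - {orbit q b}. a (card c))"
      unfolding F_def
      by (subst orbits_transpose_comp card_orbit_transpose_comp_new; simp)+
  qed
  finally show ?thesis .
qed

text \<open>The cycle index polynomial of the symmetric group, evaluated at \<open>a\<close>: the
  coefficient of \<open>t^n\<close> in \<open>exp (\<Sum>m\<ge>1. a m / m * t^m)\<close>, in the
  recursive form given by the logarithmic derivative.\<close>

fun cycle_index :: "(nat \<Rightarrow> 'b :: field_char_0) \<Rightarrow> nat \<Rightarrow> 'b" where
  "cycle_index a 0 = 1"
| "cycle_index a (Suc n) = (\<Sum>m\<le>n. a (Suc m) * cycle_index a (n - m)) / of_nat (Suc n)"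

lemma orbit_weight_eq_marked:
  assumes "finite S" "p permutes S" "x \<in> S"
  shows "orbit_weight a S p = a (card (orbit p x)) * (\<Prod>c\<in>orbit p ` S - {orbit p x}. a (card c))"
  unfolding orbit_weight_def using assms by (subst prod.remove[of _ "orbit p x"]) auto

text \<open>Joint induction on \<open>n\<close>. Marking any point writes the plain sum as
  \<open>marked_sum a a\<close>, and removing the marked point reduces a marked sum to both
  statements for one point less. The function \<open>f\<close> is arbitrary because each removal
  turns it into \<open>f \<circ> Suc\<close>.\<close>

lemma sum_orbit_weight:
  fixes S :: "'a set" and a :: "nat \<Rightarrow> 'b :: field_char_0"
  assumes "finite S" "card S = n"
  shows "(\<Sum>p | p permutes S. orbit_weight a S p) = fact n * cycle_index a n"
    and "\<And>f x. x \<in> S \<Longrightarrow> marked_sum a f S x =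
           fact (n - 1) * (\<Sum>m<n. f (Suc m) * cycle_index a (n - 1 - m))"
  using assms
proof (induction n arbitrary: S)
  case 0
  case 1 then show ?case by (simp add: orbit_weight_def)
  case 2 then show ?case by simp
next
  case (Suc n)
  have step: "marked_sum a f S x = fact n * (\<Sum>m\<le>n. f (Suc m) * cycle_index a (n - m))"
    if "finite S" "card S = Suc n" "x \<in> S" for S :: "'a set" and f x
  proof -
    define S' where "S' = S - {x}"
    have S': "S = insert x S'" "x \<notin> S'" "finite S'" "card S' = n"
      using that by (auto simp: S'_def)
    have "marked_sum a f S x = f 1 * (fact n * cycle_index a n) +
        (\<Sum>y\<in>S'. fact (n - 1) * (\<Sum>m<n. (f \<circ> Suc) (Suc m) * cycle_index a (n - 1 - m)))"
      unfolding S'(1) using S' by (subst marked_sum_insert) (simp_all add: Suc.IH)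
    also have "(\<Sum>y\<in>S'. fact (n - 1) * (\<Sum>m<n. (f \<circ> Suc) (Suc m) * cycle_index a (n - 1 - m)))
       = of_nat n * fact (n - 1) * (\<Sum>m<n. (f \<circ> Suc) (Suc m) * cycle_index a (n - 1 - m))"
      using S' by simp
    \<comment> \<open>For \<open>n = 0\<close> the truncated \<open>n - 1\<close> does no harm,
      since both sides are 0.\<close>
    also have "\<dots> = fact n * (\<Sum>m<n. f (Suc (Suc m)) * cycle_index a (n - Suc m))"
      by (cases n) simp_all
    also have "f 1 * (fact n * cycle_index a n) + \<dots> = fact n * (\<Sum>m\<le>n. f (Suc m) * cycle_index a (n - m))"
      unfolding lessThan_Suc_atMost[symmetric] sum.lessThan_Suc_shift by (simp add: algebra_simps)
    finally show ?thesis .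
  qed
  case 1
  then obtain x where x: "x \<in> S" by fastforce
  have "(\<Sum>p | p permutes S. orbit_weight a S p) = marked_sum a a S x"
    unfolding marked_sum_def using 1 x by (intro sum.cong orbit_weight_eq_marked) auto
  also have "\<dots> = fact n * (\<Sum>m\<le>n. a (Suc m) * cycle_index a (n - m))"
    using 1 x by (intro step) auto
  also have "\<dots> = fact (Suc n) * cycle_index a (Suc n)"
    by (simp del: of_nat_Suc)
  finally show ?case .
  case 2
  then show ?case using step[of S x f for x f] by (simp add: lessThan_Suc_atMost)
qed

lemma orbit_weight_eq_prod_num_cycles:
  assumes "p permutes {1..n}"
  shows "orbit_weight a {1..n} p = (\<Prod>m=1..n. a m ^ num_cycles_of_length n m p)"
proof -
  let ?C = "orbit p ` {1..n}"
  have "card c \<in> {1..n}" if c: "c \<in> ?C" for c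
  proof -
    obtain x where x: "x \<in> {1..n}" "c = orbit p x" using c by blast
    have "c \<subseteq> {1..n}" using x permutes_orbit_subset[OF assms] by blast
    moreover have "c \<noteq> {}" using x orbit_nonempty[of p x] by simp
    ultimately show ?thesis
      using card_mono[of "{1..n}" c] finite_subset[of c "{1..n}"]
      by (auto simp: Suc_le_eq card_gt_0_iff)
  qed
  hence "(\<Prod>m=1..n. \<Prod>c | c \<in> ?C \<and> card c = m. a (card c)) = (\<Prod>c\<in>?C. a (card c))"
    by (intro prod.group) auto
  moreover have "(\<Prod>c | c \<in> ?C \<and> card c = m. a (card c)) = a m ^ num_cycles_of_length n m p" for m
    by (simp add: num_cycles_of_length_def)
  ultimately show ?thesis by (simp add: orbit_weight_def)
qed

lemma sum_cycle_weights:
  fixes a :: "nat \<Rightarrow> 'b :: field_char_0"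
  shows "(\<Sum>p | p permutes {1..n}. \<Prod>m=1..n. a m ^ num_cycles_of_length n m p) = fact n * cycle_index a n"
proof -
  have "(\<Sum>p | p permutes {1..n}. \<Prod>m=1..n. a m ^ num_cycles_of_length n m p)
      = (\<Sum>p | p permutes {1..n}. orbit_weight a {1..n} p)"
    by (intro sum.cong refl orbit_weight_eq_prod_num_cycles [symmetric]) simp
  also have "\<dots> = fact n * cycle_index a n"
    by (rule sum_orbit_weight(1)) auto
  finally show ?thesis .
qed

section \<open>Coefficients as circle integrals\<close>

text \<open>\<open>F = exp \<circ> g\<close> solves \<open>F' = g' * F\<close> with
  \<open>F 0 = 1\<close>. Differentiation cancels the factors \<open>1 / m\<close> in the series of
  \<open>g\<close>, and comparing coefficients gives the recursion of
  \<open>cycle_index\<close>.\<close>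

lemma cycle_index_eq_coeff:
  fixes a :: "nat \<Rightarrow> complex"
  assumes g: "g has_fps_expansion Abs_fps (\<lambda>m. if m = 0 then 0 else a m / of_nat m)"
    and hol: "g holomorphic_on ball 0 1"
  shows "cycle_index a n = (deriv ^^ n) (\<lambda>z. exp (g z)) 0 / fact n"
proof -
  define A where "A = Abs_fps (\<lambda>m. if m = 0 then 0 else a m / of_nat m)"
  define F where "F = (\<lambda>z. exp (g z))"
  define H where "H = fps_expansion F 0"
  have holF: "F holomorphic_on ball 0 1"
    unfolding F_def by (intro holomorphic_intros hol)
  have H: "F has_fps_expansion H"
    unfolding H_def by (rule has_fps_expansion_fps_expansion[OF _ _ holF]) auto
  have "deriv F has_fps_expansion fps_deriv H" by (intro has_fps_expansion_deriv H)
  moreover have "deriv F has_fps_expansion fps_deriv A * H"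
  proof -
    have "(\<lambda>z. deriv g z * F z) has_fps_expansion fps_deriv A * H"
      using g H by (intro has_fps_expansion_mult has_fps_expansion_deriv) (simp_all add: A_def)
    moreover have "eventually (\<lambda>z. deriv F z = deriv g z * F z) (nhds 0)"
    proof -
      have "eventually (\<lambda>z::complex. z \<in> ball 0 1) (nhds 0)"
        by (intro eventually_nhds_in_open) auto
      thus ?thesis
      proof eventually_elim
        case (elim z)
        have "(g has_field_derivative deriv g z) (at z)"
          by (rule holomorphic_derivI[OF hol open_ball elim])
        hence "(F has_field_derivative exp (g z) * deriv g z) (at z)"
          unfolding F_def by (auto intro!: derivative_eq_intros)
        thus ?case by (simp add: DERIV_imp_deriv F_def mult.commute)
      qed
    qed
    ultimately show ?thesis
      by (subst has_fps_expansion_cong[of _ "\<lambda>z. deriv g z * F z", OF _ refl])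
  qed
  ultimately have ode: "fps_deriv H = fps_deriv A * H" by (rule fps_expansion_unique_complex)
  have dA: "fps_nth (fps_deriv A) m = a (Suc m)" for m
    by (simp add: A_def del: of_nat_Suc)
  have g0: "g 0 = 0"
    using has_fps_expansion_imp_0_eq_fps_nth_0[OF g] by simp
  have H0: "fps_nth H 0 = 1"
    using has_fps_expansion_imp_0_eq_fps_nth_0[OF H] by (simp add: F_def g0)
  have "fps_nth H n = cycle_index a n" for n
  proof (induction n rule: less_induct)
    case (less n)
    show ?case
    proof (cases n)
      case 0 then show ?thesis by (simp add: H0)
    next
      case (Suc k)
      have "of_nat (Suc k) * fps_nth H (Suc k) = fps_nth (fps_deriv H) k" by simp
      also have "\<dots> = (\<Sum>i=0..k. a (Suc i) * fps_nth H (k - i))"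
        by (simp only: ode fps_mult_nth dA)
      also have "\<dots> = (\<Sum>i\<le>k. a (Suc i) * cycle_index a (k - i))"
        using less Suc by (intro sum.cong) auto
      finally have "of_nat (Suc k) * fps_nth H (Suc k) = (\<Sum>i\<le>k. a (Suc i) * cycle_index a (k - i))" .
      hence "fps_nth H (Suc k) = (\<Sum>i\<le>k. a (Suc i) * cycle_index a (k - i)) / of_nat (Suc k)"
        by (simp add: field_simps del: of_nat_Suc)
      thus ?thesis using Suc by simp
    qed
  qed
  thus ?thesis using fps_nth_fps_expansion[OF H] by (simp add: F_def)
qed

text \<open>Cauchy's formula on the circle of radius \<open>exp (- x)\<close> in the coordinate
  \<open>t = exp (- w)\<close>, \<open>w = x + iy\<close>, where \<open>t^(-n)\<close> becomes
  \<open>exp (n * w)\<close>.\<close>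

lemma has_integral_coeff_circle:
  fixes f :: "complex \<Rightarrow> complex"
  assumes hol: "f holomorphic_on ball 0 1" and x: "0 < x"
  shows "((\<lambda>y. f (exp (- (of_real x + \<i> * of_real y))) * exp (of_nat n * (of_real x + \<i> * of_real y)))
           has_integral (2 * pi * ((deriv ^^ n) f 0 / fact n))) {- pi..pi}"
proof -
  define r where "r = exp (- x)"
  have r: "0 < r" "r < 1" using x by (auto simp: r_def)
  have "continuous_on (cball 0 r) f"
    using r by (intro holomorphic_on_imp_continuous_on holomorphic_on_subset[OF hol]) auto
  moreover have "f holomorphic_on ball 0 r" using r by (intro holomorphic_on_subset[OF hol]) auto
  ultimately have "((\<lambda>u. f u / (u - 0) ^ Suc n) has_contour_integral
      ((2 * pi * \<i>) / fact n * (deriv ^^ n) f 0)) (circlepath 0 r)"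
    using r by (intro Cauchy_has_contour_integral_higher_derivative_circlepath) auto
  hence "((\<lambda>t. f (r * cis t) / (r * cis t) ^ Suc n * r * \<i> * cis t) has_integral
      ((2 * pi * \<i>) / fact n * (deriv ^^ n) f 0)) {0..2*pi}"
    unfolding circlepath_def by (subst (asm) has_contour_integral_part_circlepath_iff) auto
  hence "((\<lambda>t. (- \<i>) * (f (r * cis t) / (r * cis t) ^ Suc n * r * \<i> * cis t)) has_integral
      ((- \<i>) * ((2 * pi * \<i>) / fact n * (deriv ^^ n) f 0))) {0..2*pi}"
    by (rule has_integral_mult_right)
  also have "(- \<i>) * ((2 * pi * \<i>) / fact n * (deriv ^^ n) f 0) = 2 * pi * ((deriv ^^ n) f 0 / fact n)"
    by (simp add: field_simps)
  also have "(\<lambda>t. (- \<i>) * (f (r * cis t) / (r * cis t) ^ Suc n * r * \<i> * cis t))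
           = (\<lambda>t. f (r * cis t) / (r * cis t) ^ n)"
    using r by (auto simp: fun_eq_iff field_simps)
  finally have *: "((\<lambda>t. f (r * cis t) / (r * cis t) ^ n) has_integral 2 * pi * ((deriv ^^ n) f 0 / fact n)) {0..2*pi}" .
  define h where "h = (\<lambda>t. f (r * cis t) / (r * cis t) ^ n)"
  \<comment> \<open>Periodicity replaces \<open>{0..2*pi}\<close> by \<open>{-pi..pi}\<close>, which
    has the direction \<open>y = 0\<close> of the singularity in its interior. The reflection
    further down accounts for the sign in \<open>exp (- w)\<close>.\<close>
  have per: "h (t + 2 * pi) = h t" for t
    by (simp add: h_def cis_mult[symmetric])
  have cont: "continuous_on UNIV h"
    unfolding h_def cis_conv_exp using r
    by (intro continuous_intros holomorphic_on_imp_continuous_on[OF hol, THEN continuous_on_compose2])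
       (auto simp: norm_mult)
  have int: "h integrable_on {a..b}" for a b
    by (intro integrable_continuous_real continuous_on_subset[OF cont]) auto
  have "integral {-pi..pi} h = integral {-pi..0} h + integral {0..pi} h"
    by (rule Henstock_Kurzweil_Integration.integral_combine [symmetric]) (auto intro: int)
  also have "integral {-pi..0} h = integral {-pi..0} (h \<circ> (\<lambda>t. t + 2 * pi))"
    by (simp add: per o_def)
  also have "\<dots> = integral {pi..2*pi} h"
    by (subst integral_shift) (auto intro: continuous_on_subset[OF cont])
  also have "integral {pi..2*pi} h + integral {0..pi} h = integral {0..2*pi} h"
    by (subst add.commute, rule Henstock_Kurzweil_Integration.integral_combine) (auto intro: int)
  also have "\<dots> = 2 * pi * ((deriv ^^ n) f 0 / fact n)"
    using * unfolding h_def by (rule integral_unique)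
  finally have "(h has_integral (2 * pi * ((deriv ^^ n) f 0 / fact n))) {- pi..pi}"
    using int[of "-pi" pi] by (simp add: has_integral_iff)
  hence "((\<lambda>y. h (- y)) has_integral (2 * pi * ((deriv ^^ n) f 0 / fact n))) {- pi..pi}"
    using has_integral_reflect_real[of h _ pi "- pi"] by simp
  also have "(\<lambda>y. h (- y)) = (\<lambda>y. f (exp (- (of_real x + \<i> * of_real y))) * exp (of_nat n * (of_real x + \<i> * of_real y)))"
  proof
    fix y
    have "r * cis (- y) = exp (- (of_real x + \<i> * of_real y))"
      unfolding r_def cis_conv_exp exp_of_real[symmetric] exp_add[symmetric] by (simp add: algebra_simps)
    thus "h (- y) = f (exp (- (of_real x + \<i> * of_real y))) * exp (of_nat n * (of_real x + \<i> * of_real y))"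
      unfolding h_def exp_of_nat_mult exp_minus by (simp add: divide_inverse power_inverse)
  qed
  finally show ?thesis .
qed

section \<open>Elementary estimates\<close>

lemma poly_map_of_real [simp]:
  "poly (map_poly of_real p) (of_real x :: complex) = of_real (poly p x)"
  by (induction p) (simp_all add: map_poly_pCons)

lemma pderiv_map_of_real:
  "pderiv (map_poly of_real p) = (map_poly of_real (pderiv p) :: complex poly)"
  by (intro poly_eqI) (simp add: coeff_pderiv coeff_map_poly)

lemma poly_eq_sum_atMost:
  fixes p :: "'a :: comm_semiring_1 poly"
  assumes "degree p \<le> d"
  shows "poly p x = (\<Sum>i\<le>d. coeff p i * x ^ i)"
  unfolding poly_altdef using assms
  by (intro sum.mono_neutral_left) (auto simp: coeff_eq_0)

lemma norm_poly_le:
  fixes p :: "complex poly"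
  assumes "degree p \<le> d" "norm z \<le> \<rho>" "1 \<le> \<rho>"
  shows "norm (poly p z) \<le> (\<Sum>i\<le>d. norm (coeff p i)) * \<rho> ^ d"
proof -
  have "poly p z = (\<Sum>i\<le>d. coeff p i * z ^ i)"
    by (rule poly_eq_sum_atMost[OF assms(1)])
  also have "norm \<dots> \<le> (\<Sum>i\<le>d. norm (coeff p i) * \<rho> ^ d)"
  proof (intro sum_norm_le)
    fix i assume i: "i \<in> {..d}"
    have "norm z ^ i \<le> \<rho> ^ i" using assms by (intro power_mono) auto
    also have "\<dots> \<le> \<rho> ^ d" using assms i by (intro power_increasing) auto
    finally show "norm (coeff p i * z ^ i) \<le> norm (coeff p i) * \<rho> ^ d"
      by (simp add: norm_mult norm_power mult_left_mono)
  qed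
  finally show ?thesis by (simp add: sum_distrib_right)
qed

text \<open>The first two derivatives have degrees at most \<open>k\<close> and
  \<open>k - 1\<close>, hence sizes \<open>\<rho>^k\<close> and \<open>\<rho>^(k-1)\<close> on the
  ball of radius \<open>\<rho>\<close>. The power gained in the second bound makes the Taylor
  remainder vanish on the Gaussian scale, where \<open>norm (z - w)^2\<close> is of order
  \<open>\<rho>^(-k)\<close>.\<close>

lemma poly_taylor_bounds:
  fixes p :: "complex poly"
  assumes "degree p \<le> Suc k" "1 \<le> k"
  obtains C where "C > 0"
    "\<And>\<rho> z w. 1 \<le> \<rho> \<Longrightarrow> norm z \<le> \<rho> \<Longrightarrow> norm w \<le> \<rho> \<Longrightarrow>
       norm (poly p z - poly p w) \<le> C * \<rho> ^ k * norm (z - w)"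
    "\<And>\<rho> z w. 1 \<le> \<rho> \<Longrightarrow> norm z \<le> \<rho> \<Longrightarrow> norm w \<le> \<rho> \<Longrightarrow>
       norm (poly p z - poly p w - poly (pderiv p) w * (z - w)) \<le> C * \<rho> ^ (k - 1) * norm (z - w) ^ 2"
proof -
  define A where "A = (\<Sum>i\<le>k. norm (coeff (pderiv p) i))"
  define B where "B = (\<Sum>i\<le>k - 1. norm (coeff (pderiv (pderiv p)) i))"
  have d1: "degree (pderiv p) \<le> k" using assms by (simp add: degree_pderiv)
  have d2: "degree (pderiv (pderiv p)) \<le> k - 1" using assms by (simp add: degree_pderiv)
  define C where "C = A + B + 1"
  have AB: "A \<ge> 0" "B \<ge> 0" by (auto simp: A_def B_def sum_nonneg)
  define f where "f = (\<lambda>i. poly ((pderiv ^^ i) p))"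
  have f: "(f i has_field_derivative f (Suc i) x) (at x within S)" for i x S
    unfolding f_def by (simp add: poly_DERIV DERIV_subset[OF poly_DERIV])
  show ?thesis
  proof
    show "C > 0" using AB by (simp add: C_def)
    fix \<rho> :: real and z w :: complex
    assume \<rho>: "1 \<le> \<rho>" "norm z \<le> \<rho>" "norm w \<le> \<rho>"
    have "norm (f 0 z - (\<Sum>i\<le>0. f i w * (z-w) ^ i / fact i)) \<le> (A * \<rho> ^ k) * norm (z - w) ^ Suc 0 / fact 0"
    proof (rule complex_Taylor[where S = "cball 0 \<rho>"])
      fix x assume "x \<in> cball (0::complex) \<rho>"
      thus "norm (f (Suc 0) x) \<le> A * \<rho> ^ k"
        unfolding f_def A_def using \<rho> d1 by (simp, intro norm_poly_le) auto
    qed (use \<rho> f in auto)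
    hence "norm (poly p z - poly p w) \<le> (A * \<rho> ^ k) * norm (z - w)"
      by (simp add: f_def)
    also have "\<dots> \<le> (C * \<rho> ^ k) * norm (z - w)"
      using \<rho> AB by (intro mult_right_mono) (auto simp: C_def)
    finally show "norm (poly p z - poly p w) \<le> C * \<rho> ^ k * norm (z - w)" .
    have "norm (f 0 z - (\<Sum>i\<le>Suc 0. f i w * (z-w) ^ i / fact i)) \<le>
            (B * \<rho> ^ (k-1)) * norm (z - w) ^ Suc (Suc 0) / fact (Suc 0)"
    proof (rule complex_Taylor[where S = "cball 0 \<rho>"])
      fix x assume "x \<in> cball (0::complex) \<rho>"
      thus "norm (f (Suc (Suc 0)) x) \<le> B * \<rho> ^ (k-1)"
        unfolding f_def B_def using \<rho> d2 by (simp, intro norm_poly_le) auto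
    qed (use \<rho> f in auto)
    hence "norm (poly p z - poly p w - poly (pderiv p) w * (z - w)) \<le> (B * \<rho> ^ (k-1)) * norm (z - w) ^ 2"
      by (simp add: f_def power2_eq_square algebra_simps)
    also have "\<dots> \<le> (C * \<rho> ^ (k-1)) * norm (z - w) ^ 2"
      using \<rho> AB by (intro mult_right_mono) (auto simp: C_def)
    finally show "norm (poly p z - poly p w - poly (pderiv p) w * (z - w)) \<le> C * \<rho> ^ (k-1) * norm (z - w) ^ 2" .
  qed
qed

lemma poly_over_power_tendsto:
  fixes p :: "real poly"
  assumes "degree p \<le> d"
  shows "((\<lambda>x. poly p x / x ^ d) \<longlongrightarrow> coeff p d) at_top"
proof -
  have "((\<lambda>x. \<Sum>i\<le>d. coeff p i * (x ^ i / x ^ d)) \<longlongrightarrow> (\<Sum>i\<le>d. coeff p i * (if i = d then 1 else 0))) at_top"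
  proof (intro tendsto_sum tendsto_mult tendsto_const)
    fix i assume "i \<in> {..d}"
    show "((\<lambda>x::real. x ^ i / x ^ d) \<longlongrightarrow> (if i = d then 1 else 0)) at_top"
    proof (cases "i = d")
      case True
      have "eventually (\<lambda>x::real. x ^ i / x ^ d = 1) at_top"
        using eventually_gt_at_top[of 0] by eventually_elim (use True in auto)
      thus ?thesis using True by (simp add: tendsto_eventually)
    next
      case False
      with \<open>i \<in> {..d}\<close> have "i < d" by simp
      have "filterlim (\<lambda>x::real. x ^ (d - i)) at_top at_top"
        using \<open>i < d\<close> by (intro filterlim_pow_at_top filterlim_ident) auto
      hence "((\<lambda>x::real. inverse (x ^ (d - i))) \<longlongrightarrow> 0) at_top"
        by (rule tendsto_inverse_0_at_top)
      moreover have "eventually (\<lambda>x::real. inverse (x ^ (d - i)) = x ^ i / x ^ d) at_top"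
        using eventually_gt_at_top[of 0]
        by eventually_elim (use \<open>i < d\<close> in \<open>simp add: power_diff field_simps\<close>)
      ultimately show ?thesis using False by (simp add: tendsto_cong)
    qed
  qed
  also have "(\<Sum>i\<le>d. coeff p i * (if i = d then 1 else 0)) = coeff p d"
    by (simp add: if_distrib cong: if_cong)
  also have "(\<lambda>x. \<Sum>i\<le>d. coeff p i * (x ^ i / x ^ d)) = (\<lambda>x. poly p x / x ^ d)"
    by (simp add: fun_eq_iff poly_eq_sum_atMost[OF assms] sum_divide_distrib)
  finally show ?thesis .
qed

section \<open>The logarithm of \<open>1 + iv\<close>\<close>

text \<open>On \<open>v \<ge> 0\<close> the difference has derivative
  \<open>2 * (v - arctan v) / (1 + v^2) \<ge> 0\<close>, and both sides are even. It bounds the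
  squared argument of \<open>1 + iv\<close> by twice the logarithm of its modulus.\<close>

lemma arctan_sq_le_ln:
  fixes v :: real shows "arctan v ^ 2 \<le> ln (1 + v ^ 2)"
proof -
  have *: "arctan v ^ 2 \<le> ln (1 + v ^ 2)" if "v \<ge> 0" for v :: real
  proof -
    let ?f = "\<lambda>v::real. ln (1 + v ^ 2) - arctan v ^ 2"
    have "?f 0 \<le> ?f v"
    proof (rule DERIV_nonneg_imp_nondecreasing[OF that])
      fix x :: real assume x: "0 \<le> x" "x \<le> v"
      have pos: "1 + x ^ 2 > 0" by (simp add: add_pos_nonneg)
      have "(?f has_real_derivative (2 * (x - arctan x) / (1 + x ^ 2))) (at x)"
        using pos by (auto intro!: derivative_eq_intros simp: diff_divide_distrib right_diff_distrib)
          (simp add: divide_inverse mult_ac)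
      moreover have "2 * (x - arctan x) / (1 + x ^ 2) \<ge> 0"
        using pos arctan_le_self[OF x(1)] by (intro divide_nonneg_pos) auto
      ultimately show "\<exists>y. (?f has_real_derivative y) (at x) \<and> y \<ge> 0" by blast
    qed
    thus ?thesis by simp
  qed
  show ?thesis using *[of v] *[of "-v"] by (cases "v \<ge> 0") (auto simp: arctan_minus)
qed

text \<open>Bernoulli's inequality \<open>1 + q * s \<le> (1 + s)^q\<close> for real exponents. It
  turns a decay \<open>(1 + v^2)^(-q)\<close> with growing \<open>q\<close> into a majorant
  \<open>1 / (1 + q * v^2)\<close>.\<close>

lemma ln_Bernoulli:
  fixes q s :: real assumes "q \<ge> 1" "s \<ge> 0"
  shows "ln (1 + q * s) \<le> q * ln (1 + s)"
proof -
  let ?f = "\<lambda>s::real. q * ln (1 + s) - ln (1 + q * s)"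
  have "?f 0 \<le> ?f s"
  proof (rule DERIV_nonneg_imp_nondecreasing[OF assms(2)])
    fix x :: real assume x: "0 \<le> x" "x \<le> s"
    have pos: "1 + x > 0" "1 + q * x > 0" using x assms by (auto simp: add_pos_nonneg)
    have "(?f has_real_derivative (q / (1 + x) - q / (1 + q * x))) (at x)"
      using pos by (auto intro!: derivative_eq_intros simp: field_simps)
    moreover have "q / (1 + x) - q / (1 + q * x) \<ge> 0"
      using pos x assms mult_right_mono[of 1 q x] by (auto intro!: divide_left_mono)
    ultimately show "\<exists>y. (?f has_real_derivative y) (at x) \<and> y \<ge> 0" by blast
  qed
  thus ?thesis by simp
qed

lemma Re_Ln_one_plus_i: "Re (Ln (1 + \<i> * of_real v)) = ln (1 + v ^ 2) / 2"
proof -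
  have "cmod (1 + \<i> * of_real v) = sqrt (1 + v ^ 2)" by (simp add: cmod_def)
  moreover have "1 + \<i> * of_real v \<noteq> 0" by (auto simp: complex_eq_iff)
  ultimately show ?thesis by (simp add: ln_sqrt add_pos_nonneg)
qed

lemma Im_Ln_one_plus_i: "Im (Ln (1 + \<i> * of_real v)) = arctan v"
proof -
  have "1 + \<i> * of_real v \<noteq> 0" by (auto simp: complex_eq_iff)
  thus ?thesis by (simp add: Im_Ln_eq)
qed

text \<open>Holds for all real \<open>v\<close> and is expressed through
  \<open>ln (1 + v^2)\<close>, the quantity in which the decay of the integrand is measured.\<close>

lemma norm_Ln_one_plus_i_le:
  "norm (Ln (1 + \<i> * of_real v)) \<le> ln (1 + v ^ 2) / 2 + sqrt (ln (1 + v ^ 2))"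
proof -
  have "norm (Ln (1 + \<i> * of_real v)) \<le> \<bar>ln (1 + v ^ 2) / 2\<bar> + \<bar>arctan v\<bar>"
    using cmod_le[of "Ln (1 + \<i> * of_real v)"] by (simp add: Re_Ln_one_plus_i Im_Ln_one_plus_i)
  moreover have "\<bar>arctan v\<bar> \<le> sqrt (ln (1 + v ^ 2))"
    using arctan_sq_le_ln[of v] by (simp add: real_le_rsqrt)
  ultimately show ?thesis by simp
qed

text \<open>The source of the exponent \<open>s^2 / 2\<close> in the limit of the exponential
  moments.\<close>

lemma exp_second_order:
  "((\<lambda>z::complex. (exp z - 1 - z) / z ^ 2) \<longlongrightarrow> 1 / 2) (at 0)"
proof -
  have "((\<lambda>z::complex. (exp z - 1 - z) / z ^ 2 - 1 / 2) \<longlongrightarrow> 0) (at 0)"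
  proof (rule Lim_null_comparison)
    have "eventually (\<lambda>z::complex. z \<noteq> 0) (at 0)" by (simp add: eventually_at_filter)
    thus "eventually (\<lambda>z::complex. norm ((exp z - 1 - z) / z ^ 2 - 1 / 2) \<le> exp \<bar>Re z\<bar> * norm z) (at 0)"
    proof eventually_elim
      case (elim z)
      have "norm (exp z - 1 - z - z ^ 2 / 2) \<le> exp \<bar>Re z\<bar> * norm z ^ 3 / 2"
        using Taylor_exp[of z 2] by (simp add: numeral_2_eq_2 numeral_3_eq_3 algebra_simps)
      also have "\<dots> \<le> exp \<bar>Re z\<bar> * norm z ^ 3" by simp
      finally have "norm (exp z - 1 - z - z ^ 2 / 2) / norm z ^ 2 \<le> (exp \<bar>Re z\<bar> * norm z ^ 3) / norm z ^ 2"
        by (rule divide_right_mono) simp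
      also have "\<dots> = exp \<bar>Re z\<bar> * norm z" using elim by (simp add: power3_eq_cube power2_eq_square)
      also have "norm (exp z - 1 - z - z ^ 2 / 2) / norm z ^ 2 = norm ((exp z - 1 - z - z ^ 2 / 2) / z ^ 2)"
        by (simp add: norm_divide norm_power)
      also have "(exp z - 1 - z - z ^ 2 / 2) / z ^ 2 = (exp z - 1 - z) / z ^ 2 - 1 / 2"
        using elim by (simp add: field_simps)
      finally show ?case .
    qed
    have "((\<lambda>z::complex. exp \<bar>Re z\<bar> * norm z) \<longlongrightarrow> exp \<bar>Re 0\<bar> * norm (0::complex)) (at 0)"
      by (intro tendsto_intros)
    thus "((\<lambda>z::complex. exp \<bar>Re z\<bar> * norm z) \<longlongrightarrow> 0) (at 0)" by simp
  qed
  thus ?thesis by (simp add: LIM_zero_iff)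
qed

text \<open>Together with the next limit this says
  \<open>Ln (1 + iv) = iv + v^2 / 2 + o(v^2)\<close>, from which the Gaussian arises.\<close>

lemma tendsto_ln_over_square: "((\<lambda>v::real. ln (1 + v ^ 2) / v ^ 2) \<longlongrightarrow> 1) (at 0)"
  by real_asymp

lemma tendsto_arctan_over_square: "((\<lambda>v::real. (v - arctan v) / v ^ 2) \<longlongrightarrow> 0) (at 0)"
  by real_asymp

lemma norm_Ln_one_plus_i_le_2:
  assumes "\<bar>v\<bar> \<le> 2"
  shows "norm (Ln (1 + \<i> * of_real v)) \<le> 2 * \<bar>v\<bar>"
proof -
  have ln: "ln (1 + v ^ 2) \<le> v ^ 2" by (rule ln_add_one_self_le_self) simp
  have "norm (Ln (1 + \<i> * of_real v)) \<le> ln (1 + v ^ 2) / 2 + sqrt (ln (1 + v ^ 2))"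
    by (rule norm_Ln_one_plus_i_le)
  also have "\<dots> \<le> v ^ 2 / 2 + sqrt (v ^ 2)"
    using ln by (intro add_mono divide_right_mono real_sqrt_le_mono) auto
  also have "\<dots> = \<bar>v\<bar> * \<bar>v\<bar> / 2 + \<bar>v\<bar>" by (simp add: power2_eq_square)
  also have "\<dots> \<le> \<bar>v\<bar> * 2 / 2 + \<bar>v\<bar>"
    using assms by (intro add_mono divide_right_mono mult_left_mono) auto
  finally show ?thesis by simp
qed

text \<open>The factor \<open>exp (- r)\<close> is a positive real, so the principal branch splits
  without a correction.\<close>

lemma minus_Ln_scaled:
  "- Ln (of_real (exp (- r)) * (1 + \<i> * of_real v)) = of_real r - Ln (1 + \<i> * of_real v)"
proof -
  have "1 + \<i> * of_real v \<noteq> 0" by (auto simp: complex_eq_iff)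
  hence "Ln (of_real (exp (- r)) * (1 + \<i> * of_real v)) = Ln (of_real (exp (-r))) + Ln (1 + \<i> * of_real v)"
    by (intro Ln_times_of_real) auto
  moreover have "Ln (of_real (exp (-r))) = of_real (-r)" by (subst Ln_of_real) auto
  ultimately show ?thesis by simp
qed

text \<open>Translates smallness of \<open>w = exp (- r) * (1 + iv)\<close> into a lower bound for
  \<open>r - ln (1 + v^2) / 2\<close>, the real part of \<open>- Ln w\<close>, which is the
  condition in the decay estimates.\<close>

lemma norm_scaled:
  "norm (of_real (exp (- r)) * (1 + \<i> * of_real v)) = exp (- (r - ln (1 + v ^ 2) / 2))"
proof -
  have pos: "1 + v ^ 2 > 0" by (simp add: add_pos_nonneg)
  have "norm (1 + \<i> * of_real v) = sqrt (1 + v ^ 2)" by (simp add: cmod_def)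
  also have "\<dots> = exp (ln (1 + v ^ 2) / 2)" using pos by (simp flip: ln_sqrt)
  finally have "norm (1 + \<i> * of_real v) = exp (ln (1 + v ^ 2) / 2)" .
  thus ?thesis by (simp only: norm_mult norm_of_real abs_exp_cancel exp_add [symmetric]) simp
qed

text \<open>Permits division by the common limit of the two circle integrals; its value then
  cancels.\<close>

lemma gaussian_integral_nonzero:
  "(\<integral>\<tau>. exp (- of_real (\<tau> ^ 2 / 2) :: complex) \<partial>lborel) \<noteq> 0"
proof -
  have "integrable lborel (\<lambda>x. sqrt (2 * pi) * std_normal_density x)"
    using integrable_normal_density[of 1 0] by simp
  hence int: "integrable lborel (\<lambda>x::real. exp (- (x ^ 2 / 2)))"
    by (simp add: std_normal_density_def)
  have "(\<integral>x. sqrt (2 * pi) * std_normal_density x \<partial>lborel) = sqrt (2 * pi) * 1"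
    using integral_normal_density[of 1 0] by simp
  hence "(\<integral>x. exp (- (x ^ 2 / 2)) \<partial>lborel) = sqrt (2 * pi)"
    by (simp add: std_normal_density_def)
  moreover have "(\<integral>\<tau>. exp (- of_real (\<tau> ^ 2 / 2) :: complex) \<partial>lborel) = of_real (\<integral>x. exp (- (x ^ 2 / 2)) \<partial>lborel)"
    unfolding integral_complex_of_real[symmetric] by (simp flip: exp_of_real)
  ultimately show ?thesis by simp
qed

section \<open>The saddle point method\<close>

text \<open>The polynomial is kept real and evaluated at complex points through
  \<open>map_poly of_real\<close>, so that order and monotonicity arguments apply to it on the real
  axis.\<close>

locale log_singularity =
  fixes p :: "real poly" and k :: nat and G :: "complex \<Rightarrow> complex"
  assumes k_pos: "1 \<le> k"
    and degree_p: "degree p \<le> Suc k"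
    and coeff_p: "coeff p (Suc k) = 1 / real (Suc k)"
    and continuous_G: "continuous_on (cball 0 1 - {1}) G"
    and expansion_G: "(\<lambda>w. G (exp (- w)) - poly (map_poly of_real p) (- Ln w))
          \<in> O[at 0 within {w. 0 \<le> Re w}](\<lambda>w. w)"
begin

abbreviation P :: "complex \<Rightarrow> complex" where "P \<equiv> poly (map_poly of_real p)"
abbreviation Q :: "real \<Rightarrow> real" where "Q \<equiv> poly (pderiv p)"

section \<open>Growth of the polynomial and decay of \<open>exp (P (- Ln w))\<close> off the real
  axis\<close>

lemma Q_asymp: "((\<lambda>r. Q r / r ^ k) \<longlongrightarrow> 1) at_top"
proof -
  have "coeff (pderiv p) k = 1" using coeff_p by (simp add: coeff_pderiv)
  moreover have "degree (pderiv p) \<le> k" using degree_p by (simp add: degree_pderiv)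
  ultimately show ?thesis using poly_over_power_tendsto[of "pderiv p" k] by simp
qed

lemma p_asymp: "((\<lambda>r. poly p r / r ^ Suc k) \<longlongrightarrow> 1 / real (Suc k)) at_top"
  using poly_over_power_tendsto[OF degree_p] coeff_p by simp

lemma Q_bounds: "eventually (\<lambda>r. r ^ k / 2 \<le> Q r \<and> Q r \<le> 2 * r ^ k) at_top"
proof -
  have "eventually (\<lambda>r. Q r / r ^ k > 1 / 2) at_top"
    by (rule order_tendstoD[OF Q_asymp]) simp
  moreover have "eventually (\<lambda>r. Q r / r ^ k < 2) at_top"
    by (rule order_tendstoD[OF Q_asymp]) simp
  ultimately show ?thesis using eventually_gt_at_top[of 0]
    by eventually_elim (simp add: field_simps)
qed

text \<open>Far out \<open>Q t \<ge> t^k / 2\<close>, so \<open>poly p t\<close> minus half of its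
  leading term is nondecreasing; moreover
  \<open>r^(k+1) - z^(k+1) \<ge> (r - z) * r^k\<close>.\<close>

lemma p_growth:
  obtains R where "R \<ge> 1"
    "\<And>z r. R \<le> z \<Longrightarrow> z \<le> r \<Longrightarrow> (r - z) * r ^ k / (2 * real (Suc k)) \<le> poly p r - poly p z"
proof -
  obtain R0 where R0: "\<And>r. R0 \<le> r \<Longrightarrow> r ^ k / 2 \<le> Q r"
    using Q_bounds by (auto simp: eventually_at_top_linorder)
  define R where "R = max 1 R0"
  show ?thesis
  proof
    show "R \<ge> 1" by (simp add: R_def)
    fix z r assume zr: "R \<le> z" "z \<le> r"
    let ?f = "\<lambda>t. poly p t - t ^ Suc k / (2 * real (Suc k))"
    have "?f z \<le> ?f r"
    proof (rule DERIV_nonneg_imp_nondecreasing[OF zr(2)])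
      fix t assume t: "z \<le> t" "t \<le> r"
      have "(?f has_real_derivative (Q t - t ^ k / 2)) (at t)"
      proof (intro DERIV_diff poly_DERIV)
        show "((\<lambda>t. t ^ Suc k / (2 * real (Suc k))) has_real_derivative t ^ k / 2) (at t)"
          by (auto intro!: derivative_eq_intros simp del: of_nat_Suc power_Suc)
      qed
      moreover have "Q t - t ^ k / 2 \<ge> 0" using R0[of t] zr t by (simp add: R_def)
      ultimately show "\<exists>y. (?f has_real_derivative y) (at t) \<and> y \<ge> 0" by blast
    qed
    moreover have "(r - z) * r ^ k \<le> r ^ Suc k - z ^ Suc k"
    proof -
      have "z * z ^ k \<le> z * r ^ k" using zr by (intro mult_left_mono power_mono) (auto simp: R_def)
      thus ?thesis by (simp add: algebra_simps)
    qed
    hence "(r - z) * r ^ k / (2 * real (Suc k)) \<le> (r ^ Suc k - z ^ Suc k) / (2 * real (Suc k))"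
      by (intro divide_right_mono) auto
    ultimately show "(r - z) * r ^ k / (2 * real (Suc k)) \<le> poly p r - poly p z"
      unfolding diff_divide_distrib by linarith
  qed
qed

lemma P_taylor_bounds:
  obtains C where "C > 0"
    "\<And>\<rho> (z::complex) (w::complex). 1 \<le> \<rho> \<Longrightarrow> norm z \<le> \<rho> \<Longrightarrow> norm w \<le> \<rho> \<Longrightarrow>
       norm (P z - P w) \<le> C * \<rho> ^ k * norm (z - w)"
    "\<And>\<rho> (z::complex) t. 1 \<le> \<rho> \<Longrightarrow> norm z \<le> \<rho> \<Longrightarrow> \<bar>t\<bar> \<le> \<rho> \<Longrightarrow>
       norm (P z - poly p t - Q t * (z - of_real t)) \<le> C * \<rho> ^ (k - 1) * norm (z - of_real t) ^ 2"
proof -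
  have "degree (map_poly of_real p :: complex poly) \<le> Suc k"
    using degree_p by (intro degree_le) (auto simp: coeff_map_poly coeff_eq_0)
  from poly_taylor_bounds[OF this k_pos] obtain C where C: "C > 0"
    "\<And>\<rho> (z::complex) (w::complex). 1 \<le> \<rho> \<Longrightarrow> norm z \<le> \<rho> \<Longrightarrow> norm w \<le> \<rho> \<Longrightarrow>
       norm (P z - P w) \<le> C * \<rho> ^ k * norm (z - w)"
    "\<And>\<rho> (z::complex) (w::complex). 1 \<le> \<rho> \<Longrightarrow> norm z \<le> \<rho> \<Longrightarrow> norm w \<le> \<rho> \<Longrightarrow>
       norm (P z - P w - poly (pderiv (map_poly of_real p)) w * (z - w)) \<le> C * \<rho> ^ (k - 1) * norm (z - w) ^ 2"
    by blast
  show ?thesis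
  proof (rule that[OF C(1,2)])
    fix \<rho> z t assume "1 \<le> \<rho>" "norm (z :: complex) \<le> \<rho>" "\<bar>t\<bar> \<le> \<rho>"
    thus "norm (P z - poly p t - Q t * (z - of_real t)) \<le> C * \<rho> ^ (k - 1) * norm (z - of_real t) ^ 2"
      using C(3)[of \<rho> z "of_real t"] by (simp add: pderiv_map_of_real)
  qed
qed

text \<open>
  Write \<open>r - Ln (1 + iv) = z - i\<phi>\<close> with \<open>z = r - ln (1 + v\<^sup>2) / 2\<close>. The linear Taylor term in \<open>\<phi>\<close> at \<open>z\<close>
  is imaginary and \<open>\<phi>\<^sup>2 = arctan\<^sup>2 v \<le> ln (1 + v\<^sup>2)\<close>, so the loss from \<open>r\<close> to \<open>z\<close> dominates.
\<close>
lemma Re_P_decay: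
  obtains R c where "R \<ge> 1" "c > 0"
    "\<And>r v. R \<le> r - ln (1 + v ^ 2) / 2 \<Longrightarrow>
       Re (P (of_real r - Ln (1 + \<i> * of_real v))) - poly p r \<le> - c * (ln (1 + v ^ 2) * r ^ k)"
proof -
  obtain R where R: "R \<ge> 1"
    "\<And>z r. R \<le> z \<Longrightarrow> z \<le> r \<Longrightarrow> (r - z) * r ^ k / (2 * real (Suc k)) \<le> poly p r - poly p z"
    using p_growth by blast
  obtain C where C: "C > 0"
    "\<And>\<rho> (z::complex) t. 1 \<le> \<rho> \<Longrightarrow> norm z \<le> \<rho> \<Longrightarrow> \<bar>t\<bar> \<le> \<rho> \<Longrightarrow>
       norm (P z - poly p t - Q t * (z - of_real t)) \<le> C * \<rho> ^ (k - 1) * norm (z - of_real t) ^ 2"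
    using P_taylor_bounds by metis
  \<comment> \<open>Since \<open>r - z = L / 2\<close>, the growth of \<open>p\<close> yields a loss
    of \<open>2 * c * L * r^k\<close>; half of it pays for the Taylor remainder.\<close>
  define c where "c = 1 / (8 * real (Suc k))"
  have c: "c > 0" by (simp add: c_def)
  define D where "D = C * 3 ^ (k - 1)"
  have D: "D > 0" using C by (simp add: D_def)
  \<comment> \<open>The bound \<open>z \<ge> D / c\<close> gives
    \<open>D * z^(k-1) \<le> c * z^k\<close>, so the remainder fits into the reserved half.\<close>
  define R' where "R' = max R (D / c)"
  show ?thesis
  proof
    show "R' \<ge> 1" using R by (simp add: R'_def)
    show "c > 0" by fact
    fix r v :: real assume a: "R' \<le> r - ln (1 + v ^ 2) / 2"
    define L where "L = ln (1 + v ^ 2)"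
    define z where "z = r - L / 2"
    define \<phi> where "\<phi> = arctan v"
    have L: "L \<ge> 0" by (simp add: L_def)
    have z: "R \<le> z" "D / c \<le> z" "z \<le> r" "1 \<le> z" using a L R(1) unfolding L_def[symmetric] z_def R'_def by auto
    have \<phi>: "\<phi> ^ 2 \<le> L" unfolding \<phi>_def L_def by (rule arctan_sq_le_ln)
    have "pi / 2 < 2" using pi_less_4 by simp
    hence \<phi>2: "\<bar>\<phi>\<bar> \<le> 2" using arctan_bounded[of v] by (auto simp: \<phi>_def abs_le_iff)
    have eq: "of_real r - Ln (1 + \<i> * of_real v) = of_real z - \<i> * of_real \<phi>"
      by (rule complex_eqI) (simp_all add: Re_Ln_one_plus_i Im_Ln_one_plus_i z_def L_def \<phi>_def)
    have "norm (P (of_real z - \<i> * of_real \<phi>) - poly p z - Q z * (of_real z - \<i> * of_real \<phi> - of_real z))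
            \<le> C * (3 * z) ^ (k - 1) * norm (of_real z - \<i> * of_real \<phi> - complex_of_real z) ^ 2"
    proof (rule C(2)[where \<rho> = "3 * z" and z = "of_real z - \<i> * of_real \<phi>" and t = z])
      have "norm (of_real z - \<i> * of_real \<phi>) \<le> \<bar>z\<bar> + \<bar>\<phi>\<bar>"
        by (rule order_trans[OF norm_triangle_ineq4]) (simp add: norm_mult)
      thus "norm (of_real z - \<i> * of_real \<phi>) \<le> 3 * z" using z \<phi>2 by simp
    qed (use z in auto)
    hence "Re (P (of_real z - \<i> * of_real \<phi>) - poly p z - Q z * (of_real z - \<i> * of_real \<phi> - of_real z))
           \<le> C * (3 * z) ^ (k - 1) * \<phi> ^ 2"
      using complex_Re_le_cmod order_trans by (fastforce simp: norm_mult)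
    hence "Re (P (of_real z - \<i> * of_real \<phi>)) - poly p z \<le> D * z ^ (k - 1) * \<phi> ^ 2"
      by (simp add: D_def power_mult_distrib)
    also have "\<dots> \<le> D * z ^ (k - 1) * L" using D z \<phi> by (intro mult_left_mono) auto
    also have "\<dots> \<le> (c * z) * z ^ (k - 1) * L"
      using z c L by (intro mult_right_mono) (auto simp: field_simps)
    also have "\<dots> = c * (z ^ k * L)" using k_pos by (cases k) auto
    also have "\<dots> \<le> c * (r ^ k * L)"
      using c z L by (intro mult_left_mono mult_right_mono power_mono) auto
    finally have 1: "Re (P (of_real z - \<i> * of_real \<phi>)) - poly p z \<le> c * (r ^ k * L)" .
    have "(r - z) * r ^ k / (2 * real (Suc k)) = 2 * (c * (r ^ k * L))"
      by (simp add: z_def c_def field_simps)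
    with R(2)[of z r] z have "2 * (c * (r ^ k * L)) \<le> poly p r - poly p z" by simp
    with 1 show "Re (P (of_real r - Ln (1 + \<i> * of_real v))) - poly p r \<le> - c * (ln (1 + v ^ 2) * r ^ k)"
      unfolding eq by (simp add: L_def mult_ac)
  qed
qed

text \<open>The point \<open>r - Ln (1 + iv)\<close> has norm at most
  \<open>r + 2 \<le> 3 * r\<close>, so the Taylor bounds apply with radius
  \<open>3 * r\<close>.\<close>

lemma P_diff_bound:
  obtains C where "C > 0"
    "\<And>r v. 1 \<le> r - ln (1 + v ^ 2) / 2 \<Longrightarrow>
       norm (P (of_real r - Ln (1 + \<i> * of_real v)) - poly p r)
         \<le> C * r ^ k * norm (Ln (1 + \<i> * of_real v))"
    "\<And>r v. 1 \<le> r - ln (1 + v ^ 2) / 2 \<Longrightarrow>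
       norm (P (of_real r - Ln (1 + \<i> * of_real v)) - poly p r + Q r * Ln (1 + \<i> * of_real v))
         \<le> C * r ^ (k - 1) * norm (Ln (1 + \<i> * of_real v)) ^ 2"
proof -
  obtain C where C: "C > 0"
    "\<And>\<rho> (z::complex) (w::complex). 1 \<le> \<rho> \<Longrightarrow> norm z \<le> \<rho> \<Longrightarrow> norm w \<le> \<rho> \<Longrightarrow>
       norm (P z - P w) \<le> C * \<rho> ^ k * norm (z - w)"
    "\<And>\<rho> (z::complex) t. 1 \<le> \<rho> \<Longrightarrow> norm z \<le> \<rho> \<Longrightarrow> \<bar>t\<bar> \<le> \<rho> \<Longrightarrow>
       norm (P z - poly p t - Q t * (z - of_real t)) \<le> C * \<rho> ^ (k - 1) * norm (z - of_real t) ^ 2"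
    using P_taylor_bounds by metis
  have bd: "norm (of_real r - Ln (1 + \<i> * of_real v)) \<le> 3 * r \<and> 1 \<le> r"
    if "1 \<le> r - ln (1 + v ^ 2) / 2" for r v
  proof -
    have L: "ln (1 + v ^ 2) \<ge> 0" by simp
    have "norm (of_real r - Ln (1 + \<i> * of_real v)) \<le> \<bar>r - ln (1 + v ^ 2) / 2\<bar> + \<bar>arctan v\<bar>"
      using cmod_le[of "of_real r - Ln (1 + \<i> * of_real v)"]
      by (simp add: Re_Ln_one_plus_i Im_Ln_one_plus_i)
    moreover have "\<bar>arctan v\<bar> \<le> 2" using arctan_bounded[of v] pi_less_4 by (auto simp: abs_le_iff)
    ultimately show ?thesis using that L by linarith
  qed
  define C' where "C' = C * 3 ^ k"
  show ?thesis
  proof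
    show "C' > 0" using C by (simp add: C'_def)
    fix r v :: real assume a: "1 \<le> r - ln (1 + v ^ 2) / 2"
    note b = bd[OF a]
    let ?l = "Ln (1 + \<i> * of_real v)"
    have "norm (P (of_real r - ?l) - P (of_real r)) \<le> C * (3 * r) ^ k * norm (of_real r - ?l - of_real r)"
      using b by (intro C(2)) auto
    thus "norm (P (of_real r - ?l) - poly p r) \<le> C' * r ^ k * norm ?l"
      by (simp add: C'_def power_mult_distrib mult_ac)
    have "norm (P (of_real r - ?l) - poly p r - Q r * (of_real r - ?l - of_real r))
        \<le> C * (3 * r) ^ (k - 1) * norm (of_real r - ?l - of_real r) ^ 2"
      using b by (intro C(3)) auto
    also have "\<dots> = (C * 3 ^ (k - 1)) * (r ^ (k - 1) * norm ?l ^ 2)"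
      by (simp add: power_mult_distrib)
    also have "\<dots> \<le> C' * (r ^ (k - 1) * norm ?l ^ 2)"
      unfolding C'_def using C b by (intro mult_right_mono mult_left_mono power_increasing) auto
    finally show "norm (P (of_real r - ?l) - poly p r + Q r * ?l) \<le> C' * r ^ (k - 1) * norm ?l ^ 2"
      by simp
  qed
qed

text \<open>Split \<open>u = 1 + (u - 1)\<close>. With \<open>L = ln (1 + v^2)\<close> the second
  part costs at most \<open>A * C * r^((k-1)/2) * (L / 2 + sqrt L)\<close>. The term in
  \<open>L\<close> is small against the decay \<open>c * L * r^k\<close>; the term in
  \<open>sqrt L\<close> is not when \<open>L\<close> is tiny, but completing the square bounds it by
  part of the decay plus a constant, which becomes \<open>K\<close>.\<close>

lemma Re_P_decay_perturbed:
  assumes "A \<ge> 0"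
  obtains R c K where "R \<ge> 1" "c > 0"
    "\<And>r v u. R \<le> r - ln (1 + v ^ 2) / 2 \<Longrightarrow> norm (u - 1) \<le> A / sqrt (r ^ Suc k) \<Longrightarrow>
       Re (u * (P (of_real r - Ln (1 + \<i> * of_real v)) - poly p r)) \<le> K - c * (ln (1 + v ^ 2) * r ^ k)"
proof -
  obtain R c where R: "R \<ge> 1" "c > 0"
    "\<And>r v. R \<le> r - ln (1 + v ^ 2) / 2 \<Longrightarrow>
       Re (P (of_real r - Ln (1 + \<i> * of_real v))) - poly p r \<le> - c * (ln (1 + v ^ 2) * r ^ k)"
    using Re_P_decay by blast
  obtain C where C: "C > 0"
    "\<And>r v. 1 \<le> r - ln (1 + v ^ 2) / 2 \<Longrightarrow>
       norm (P (of_real r - Ln (1 + \<i> * of_real v)) - poly p r)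
         \<le> C * r ^ k * norm (Ln (1 + \<i> * of_real v))"
    using P_diff_bound by metis
  define B where "B = A * C"
  have B: "B \<ge> 0" using assms C by (simp add: B_def)
  \<comment> \<open>From \<open>r \<ge> 2 * B / c\<close> and \<open>r \<le> sqrt r * s\<close>,
    which uses \<open>k \<ge> 1\<close>, one gets \<open>B / sqrt r \<le> c / 2 * s\<close>, so the
    term in \<open>L\<close> takes a quarter of the decay.\<close>
  define R' where "R' = max R (2 * B / c)"
  show ?thesis
  proof
    show "R' \<ge> 1" using R by (simp add: R'_def)
    show "c / 2 > 0" using R by simp
    fix r v :: real and u :: complex
    assume a: "R' \<le> r - ln (1 + v ^ 2) / 2" and u: "norm (u - 1) \<le> A / sqrt (r ^ Suc k)"
    define L where "L = ln (1 + v ^ 2)"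
    have L: "L \<ge> 0" by (simp add: L_def)
    have r: "R \<le> r - ln (1 + v ^ 2) / 2" "1 \<le> r" "2 * B / c \<le> r" "1 \<le> r - ln (1 + v ^ 2) / 2"
      using a L R(1) unfolding L_def[symmetric] R'_def by auto
    define D where "D = P (of_real r - Ln (1 + \<i> * of_real v)) - poly p r"
    define s where "s = sqrt (r ^ k)"
    have s: "s > 0" "s * s = r ^ k" using r by (auto simp: s_def)
    have sq: "sqrt (r ^ Suc k) = s * sqrt r" by (simp add: s_def real_sqrt_mult)
    define b where "b = s * sqrt L"
    have b: "b \<ge> 0" "b ^ 2 = L * r ^ k" using s L by (simp_all add: b_def power_mult_distrib) (simp add: power2_eq_square)
    have "norm ((u - 1) * D) \<le> (A / (s * sqrt r)) * (C * r ^ k * (L / 2 + sqrt L))"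
      unfolding norm_mult
    proof (rule mult_mono)
      have "norm D \<le> C * r ^ k * norm (Ln (1 + \<i> * of_real v))"
        unfolding D_def by (rule C(2)) fact
      also have "\<dots> \<le> C * r ^ k * (L / 2 + sqrt L)"
        using C r norm_Ln_one_plus_i_le[of v] by (intro mult_left_mono) (auto simp: L_def)
      finally show "norm D \<le> C * r ^ k * (L / 2 + sqrt L)" .
    qed (use u sq assms s r in auto)
    also have "\<dots> = B / sqrt r * (s * L / 2 + b)"
      using s r by (simp add: B_def b_def field_simps flip: s(2))
    also have "\<dots> \<le> B / sqrt r * (s * L / 2) + B * b"
    proof -
      have "B / sqrt r * b \<le> B / 1 * b" using r B b by (intro mult_right_mono divide_left_mono) auto
      thus ?thesis by (simp add: algebra_simps)
    qed
    also have "B / sqrt r * (s * L / 2) \<le> c / 4 * (L * r ^ k)"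
    proof -
      have rs: "r \<le> sqrt r * s"
      proof -
        have "sqrt r * sqrt r \<le> sqrt r * s"
          unfolding s_def using r k_pos self_le_power[of r k] by (intro mult_left_mono) auto
        thus ?thesis using r by simp
      qed
      have "2 * B \<le> c * r" using r R by (simp add: field_simps)
      also have "\<dots> \<le> c * (sqrt r * s)" using rs R by (intro mult_left_mono) auto
      finally have "B / sqrt r \<le> c / 2 * s" using r by (simp add: field_simps)
      hence "B / sqrt r * (s * L / 2) \<le> c / 2 * s * (s * L / 2)"
        using s L by (intro mult_right_mono) auto
      also have "\<dots> = c / 4 * (L * r ^ k)" by (simp flip: s(2))
      finally show ?thesis .
    qed
    \<comment> \<open>Completing the square; another quarter of the decay is spent.\<close>
    also have "B * b \<le> c / 4 * b ^ 2 + B ^ 2 / c"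
    proof -
      have "0 \<le> (c / 2 * b - B) ^ 2" by simp
      thus ?thesis using R by (simp add: field_simps power2_eq_square)
    qed
    finally have 1: "norm ((u - 1) * D) \<le> c / 2 * (L * r ^ k) + B ^ 2 / c"
      by (simp add: b(2) algebra_simps)
    have "Re (u * D) = Re D + Re ((u - 1) * D)" by (simp add: algebra_simps)
    also have "\<dots> \<le> - c * (L * r ^ k) + (c / 2 * (L * r ^ k) + B ^ 2 / c)"
      using 1 complex_Re_le_cmod[of "(u - 1) * D"] R(3)[OF r(1)]
      unfolding D_def L_def by (intro add_mono) auto
    finally have "Re (u * D) \<le> B ^ 2 / c - c / 2 * (L * r ^ k)" by linarith
    thus "Re (u * (P (of_real r - Ln (1 + \<i> * of_real v)) - poly p r)) \<le> B ^ 2 / c - c / 2 * (ln (1 + v ^ 2) * r ^ k)"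
      unfolding D_def L_def .
  qed
qed

text \<open>The decay is \<open>(1 + v^2)^(-q)\<close> with \<open>q = c * r^k\<close>. Bernoulli
  weakens it to \<open>1 / (1 + q * v^2)\<close>, and \<open>Q r \<le> 2 * r^k\<close> gives
  \<open>q * v^2 \<ge> c / 2 * \<tau>^2\<close>. The resulting majorant is integrable in
  \<open>\<tau>\<close> and free of \<open>r\<close> and \<open>u\<close>.\<close>

lemma exp_P_dominated:
  assumes "A \<ge> 0"
  obtains R c K where "R \<ge> 1" "c > 0" "K > 0"
    "\<And>r \<tau> u. R \<le> r - ln (1 + (\<tau> / sqrt (Q r)) ^ 2) / 2 \<Longrightarrow> norm (u - 1) \<le> A / sqrt (r ^ Suc k) \<Longrightarrow>
       norm (exp (u * (P (of_real r - Ln (1 + \<i> * of_real (\<tau> / sqrt (Q r)))) - poly p r)))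
         \<le> K / (1 + c * \<tau> ^ 2)"
proof -
  obtain R c K where R: "R \<ge> 1" "c > 0"
    "\<And>r v u. R \<le> r - ln (1 + v ^ 2) / 2 \<Longrightarrow> norm (u - 1) \<le> A / sqrt (r ^ Suc k) \<Longrightarrow>
       Re (u * (P (of_real r - Ln (1 + \<i> * of_real v)) - poly p r)) \<le> K - c * (ln (1 + v ^ 2) * r ^ k)"
    using Re_P_decay_perturbed[OF assms] by blast
  obtain R0 where R0: "\<And>r. R0 \<le> r \<Longrightarrow> r ^ k / 2 \<le> Q r \<and> Q r \<le> 2 * r ^ k"
    using Q_bounds by (auto simp: eventually_at_top_linorder)
  \<comment> \<open>The entry \<open>1 / c\<close> ensures \<open>q \<ge> 1\<close>, as
    \<open>ln_Bernoulli\<close> requires.\<close>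
  define R' where "R' = max (max R R0) (1 / c)"
  show ?thesis
  proof
    show "R' \<ge> 1" using R by (simp add: R'_def)
    show "c / 2 > 0" using R by simp
    show "exp K > 0" by simp
    fix r \<tau> :: real and u :: complex
    define v where "v = \<tau> / sqrt (Q r)"
    assume a: "R' \<le> r - ln (1 + (\<tau> / sqrt (Q r)) ^ 2) / 2" and u: "norm (u - 1) \<le> A / sqrt (r ^ Suc k)"
    have L: "ln (1 + v ^ 2) \<ge> 0" by simp
    have r: "R \<le> r - ln (1 + v ^ 2) / 2" "R0 \<le> r" "1 / c \<le> r" "1 \<le> r"
      using a L R(1) unfolding v_def[symmetric] R'_def by linarith+
    have Q: "Q r > 0" using R0[OF r(2)] r by (meson half_gt_zero less_le_trans zero_less_power zero_less_one)
    define q where "q = c * r ^ k"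
    have "1 \<le> c * r" using r R by (simp add: field_simps)
    also have "\<dots> \<le> q" unfolding q_def using r R self_le_power[of r k] k_pos by (intro mult_left_mono) auto
    finally have q: "q \<ge> 1" .
    have "c / 2 * \<tau> ^ 2 \<le> q * v ^ 2"
    proof -
      have "c / 2 * \<tau> ^ 2 = (c / 2 * Q r) * v ^ 2" using Q by (simp add: v_def power_divide)
      also have "\<dots> \<le> q * v ^ 2" using R0[OF r(2)] R unfolding q_def by (intro mult_right_mono) auto
      finally show ?thesis .
    qed
    hence "ln (1 + c / 2 * \<tau> ^ 2) \<le> ln (1 + q * v ^ 2)"
      using R by (intro ln_mono) (auto simp: add_pos_nonneg)
    also have "\<dots> \<le> q * ln (1 + v ^ 2)" using q by (intro ln_Bernoulli) auto
    finally have ln: "ln (1 + c / 2 * \<tau> ^ 2) \<le> q * ln (1 + v ^ 2)" .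
    have pos: "1 + c / 2 * \<tau> ^ 2 > 0" using R by (auto simp: add_pos_nonneg)
    have "Re (u * (P (of_real r - Ln (1 + \<i> * of_real v)) - poly p r)) \<le> K - q * ln (1 + v ^ 2)"
      using R(3)[OF r(1) u] by (simp add: q_def mult_ac)
    also have "\<dots> \<le> K - ln (1 + c / 2 * \<tau> ^ 2)" using ln by simp
    finally have "norm (exp (u * (P (of_real r - Ln (1 + \<i> * of_real v)) - poly p r)))
        \<le> exp (K - ln (1 + c / 2 * \<tau> ^ 2))" by simp
    also have "\<dots> = exp K / (1 + c / 2 * \<tau> ^ 2)" using pos by (simp add: exp_diff)
    finally show "norm (exp (u * (P (of_real r - Ln (1 + \<i> * of_real (\<tau> / sqrt (Q r)))) - poly p r)))
         \<le> exp K / (1 + c / 2 * \<tau> ^ 2)" unfolding v_def .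
  qed
qed

section \<open>The normalised integrand: pointwise limit and integrable majorant\<close>

lemma expansion_bound:
  obtains \<delta> B where "\<delta> > 0" "B \<ge> 0"
    "\<And>w. w \<noteq> 0 \<Longrightarrow> 0 \<le> Re w \<Longrightarrow> norm w < \<delta> \<Longrightarrow> norm (G (exp (- w)) - P (- Ln w)) \<le> B * norm w"
proof -
  obtain B where B: "B > 0" "eventually (\<lambda>w. norm (G (exp (- w)) - P (- Ln w)) \<le> B * norm w)
      (at 0 within {w. 0 \<le> Re w})"
    using expansion_G by (elim landau_o.bigE) auto
  from B(2) obtain \<delta> where \<delta>: "\<delta> > 0"
    "\<And>w. 0 \<le> Re w \<Longrightarrow> w \<noteq> 0 \<Longrightarrow> dist w 0 < \<delta> \<Longrightarrow> norm (G (exp (- w)) - P (- Ln w)) \<le> B * norm w"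
    unfolding eventually_at by (metis mem_Collect_eq)
  show ?thesis using that[of \<delta> B] \<delta> B by auto
qed

text \<open>
  The Cauchy integrand on the circle \<open>\<bar>t\<bar> = exp (-x)\<close>, \<open>x = exp (-r)\<close>, at the point \<open>t = exp (-x (1 + iv))\<close>,
  rescaled by \<open>v = \<tau> / sqrt (Q r)\<close> and divided by its size at \<open>v = 0\<close>. The factor \<open>t\<^sup>-\<^sup>n\<close> appears through
  the saddle point equation \<open>n x = Q r\<close>.
\<close>
definition integrand :: "real \<Rightarrow> complex \<Rightarrow> real \<Rightarrow> complex" where
  "integrand r u \<tau> =
     exp (u * (G (exp (- (of_real (exp (- r)) * (1 + \<i> * of_real (\<tau> / sqrt (Q r)))))) - of_real (poly p r))
          + \<i> * of_real (Q r * (\<tau> / sqrt (Q r))))"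

lemma continuous_G_exp:
  assumes "continuous_on S f" "\<And>x. x \<in> S \<Longrightarrow> 0 < Re (f x)"
  shows "continuous_on S (\<lambda>x. G (exp (- f x)))"
proof (rule continuous_on_compose2[OF continuous_G])
  show "continuous_on S (\<lambda>x. exp (- f x))" by (intro continuous_intros assms)
  show "(\<lambda>x. exp (- f x)) ` S \<subseteq> cball 0 1 - {1}"
  proof
    fix y assume "y \<in> (\<lambda>x. exp (- f x)) ` S"
    then obtain x where x: "x \<in> S" "y = exp (- f x)" by blast
    hence "norm y < 1" using assms(2) by simp
    thus "y \<in> cball 0 1 - {1}" by auto
  qed
qed

lemma integrand_measurable [measurable]: "integrand r u \<in> borel_measurable lborel"
proof -
  have "continuous_on UNIV (integrand r u)"
    unfolding integrand_def divide_inverse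
    by (intro continuous_intros continuous_G_exp) auto
  thus ?thesis by (simp add: borel_measurable_continuous_onI)
qed

text \<open>The exponent is a sum of four terms: the error of the expansion of \<open>G\<close>, the
  effect of \<open>u - 1\<close>, the Taylor remainder of \<open>P\<close> at \<open>r\<close>, and
  the linear Taylor term combined with the oscillating factor. The first three vanish and the last
  one gives the Gaussian.\<close>

lemma integrand_tendsto:
  assumes r: "filterlim r at_top F"
    and u: "eventually (\<lambda>n. norm (u n - 1) \<le> A / sqrt (r n ^ Suc k)) F" "(u \<longlongrightarrow> 1) F"
  shows "((\<lambda>n. integrand (r n) (u n) \<tau>) \<longlongrightarrow> exp (- of_real (\<tau> ^ 2 / 2))) F"
proof -
  obtain \<delta> B where B: "\<delta> > 0" "B \<ge> 0"
    "\<And>w. w \<noteq> 0 \<Longrightarrow> 0 \<le> Re w \<Longrightarrow> norm w < \<delta> \<Longrightarrow> norm (G (exp (- w)) - P (- Ln w)) \<le> B * norm w"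
    using expansion_bound by blast
  obtain C where C: "C > 0"
    "\<And>r v. 1 \<le> r - ln (1 + v ^ 2) / 2 \<Longrightarrow>
       norm (P (of_real r - Ln (1 + \<i> * of_real v)) - poly p r)
         \<le> C * r ^ k * norm (Ln (1 + \<i> * of_real v))"
    "\<And>r v. 1 \<le> r - ln (1 + v ^ 2) / 2 \<Longrightarrow>
       norm (P (of_real r - Ln (1 + \<i> * of_real v)) - poly p r + Q r * Ln (1 + \<i> * of_real v))
         \<le> C * r ^ (k - 1) * norm (Ln (1 + \<i> * of_real v)) ^ 2"
    using P_diff_bound by metis
  define v where "v = (\<lambda>n. \<tau> / sqrt (Q (r n)))"
  define w where "w = (\<lambda>n. of_real (exp (- r n)) * (1 + \<i> * of_real (v n)))"
  define l where "l = (\<lambda>n. Ln (1 + \<i> * of_real (v n)))"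
  have Qr: "eventually (\<lambda>n. r n ^ k / 2 \<le> Q (r n) \<and> Q (r n) \<le> 2 * r n ^ k) F"
    using Q_bounds r by (rule eventually_compose_filterlim)
  have r1: "eventually (\<lambda>n. r n \<ge> 1) F" using r by (simp add: filterlim_at_top)
  have r2: "eventually (\<lambda>n. r n \<ge> 2) F" using r by (simp add: filterlim_at_top)
  have rk: "filterlim (\<lambda>n. r n ^ k / 2) at_top F"
    using filterlim_tendsto_pos_mult_at_top[OF tendsto_const[of "1/2::real"] _ filterlim_pow_at_top[OF _ r, of k]] k_pos
    by simp
  have Qtop: "filterlim (\<lambda>n. Q (r n)) at_top F"
    by (rule filterlim_at_top_mono[OF rk]) (use Qr in eventually_elim, simp)
  have v0: "(v \<longlongrightarrow> 0) F"
    unfolding v_def by (intro tendsto_divide_0[OF tendsto_const] filterlim_at_top_imp_at_infinity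
        filterlim_compose[OF sqrt_at_top Qtop])
  have Qv2: "eventually (\<lambda>n. Q (r n) * v n ^ 2 = \<tau> ^ 2) F"
    using Qr r1
  proof eventually_elim
    case (elim n)
    have "0 < r n ^ k / 2" using elim by simp
    hence "Q (r n) > 0" using elim by linarith
    thus ?case by (simp add: v_def power_divide)
  qed
  have vsmall: "eventually (\<lambda>n. \<bar>v n\<bar> \<le> 1) F"
    using order_tendstoD(2)[OF tendsto_rabs_zero[OF v0], of 1] by (auto elim: eventually_mono)
  have z1: "eventually (\<lambda>n. 1 \<le> r n - ln (1 + v n ^ 2) / 2) F"
    using r2 vsmall
  proof eventually_elim
    case (elim n)
    have "ln (1 + v n ^ 2) \<le> v n ^ 2" by (rule ln_add_one_self_le_self) simp
    also have "\<dots> \<le> 1" using elim by (simp add: abs_square_le_1)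
    finally show ?case using elim by simp
  qed
  have l_le: "eventually (\<lambda>n. norm (l n) \<le> 2 * \<bar>v n\<bar>) F"
    using vsmall by eventually_elim (auto simp: l_def intro: norm_Ln_one_plus_i_le_2)
  have ex0: "((\<lambda>n. exp (- r n)) \<longlongrightarrow> 0) F"
    using filterlim_compose[OF exp_at_bot, of "\<lambda>n. - r n"] r by (simp add: filterlim_uminus_at_top)
  have w0: "(w \<longlongrightarrow> 0) F"
  proof -
    have "(w \<longlongrightarrow> of_real 0 * (1 + \<i> * of_real 0)) F"
      unfolding w_def by (intro tendsto_intros ex0 v0)
    thus ?thesis by simp
  qed
  have wd: "eventually (\<lambda>n. norm (w n) < \<delta>) F"
    using tendsto_norm_zero[OF w0] B(1) by (rule order_tendstoD)
  have w_ne: "w n \<noteq> 0" "0 \<le> Re (w n)" for n by (auto simp: w_def complex_eq_iff)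
  have rinv: "((\<lambda>n. inverse (r n)) \<longlongrightarrow> 0) F"
    by (rule tendsto_inverse_0_at_top[OF r])
  have rsinv: "((\<lambda>n. inverse (sqrt (r n))) \<longlongrightarrow> 0) F"
    by (rule tendsto_inverse_0_at_top[OF filterlim_compose[OF sqrt_at_top r]])

  have T1: "((\<lambda>n. u n * (G (exp (- w n)) - P (- Ln (w n)))) \<longlongrightarrow> 1 * 0) F"
  proof (intro tendsto_mult u(2))
    show "((\<lambda>n. G (exp (- w n)) - P (- Ln (w n))) \<longlongrightarrow> 0) F"
    proof (rule Lim_null_comparison)
      show "eventually (\<lambda>n. norm (G (exp (- w n)) - P (- Ln (w n))) \<le> B * norm (w n)) F"
        using wd by eventually_elim (use B w_ne in auto)
      show "((\<lambda>n. B * norm (w n)) \<longlongrightarrow> 0) F"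
        by (rule tendsto_mult_right_zero[OF tendsto_norm_zero[OF w0]])
    qed
  qed
  \<comment> \<open>Orders of magnitude: \<open>r^(-(k+1)/2)\<close> from \<open>u - 1\<close>,
    \<open>r^k\<close> from the derivative of \<open>P\<close>, and \<open>r^(-k/2)\<close> from
    \<open>v\<close>; the product is \<open>r^(-1/2)\<close>.\<close>
  have T2: "((\<lambda>n. (u n - 1) * (P (of_real (r n) - l n) - poly p (r n))) \<longlongrightarrow> 0) F"
  proof (rule Lim_null_comparison)
    show "eventually (\<lambda>n. norm ((u n - 1) * (P (of_real (r n) - l n) - poly p (r n))) \<le>
             (\<bar>A\<bar> * C * 2 * sqrt 2 * \<bar>\<tau>\<bar>) * inverse (sqrt (r n))) F"
      using u(1) z1 l_le r1 Qr
    proof eventually_elim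
      case (elim n)
      define s where "s = sqrt (r n ^ k)"
      have s: "s > 0" "s * s = r n ^ k" using elim by (auto simp: s_def)
      have sq: "sqrt (r n ^ Suc k) = s * sqrt (r n)" by (simp add: s_def real_sqrt_mult)
      have "s / sqrt 2 = sqrt (r n ^ k / 2)" by (simp add: s_def real_sqrt_divide)
      also have "\<dots> \<le> sqrt (Q (r n))" using elim by (intro real_sqrt_le_mono) auto
      finally have sQ: "s / sqrt 2 \<le> sqrt (Q (r n))" .
      have s2: "0 < s / sqrt 2" using s by simp
      have Q0: "0 < sqrt (Q (r n))" using s2 sQ by linarith
      have "\<bar>v n\<bar> = \<bar>\<tau>\<bar> / sqrt (Q (r n))" using Q0 by (simp add: v_def abs_divide)
      also have "\<dots> \<le> \<bar>\<tau>\<bar> / (s / sqrt 2)"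
        using sQ mult_pos_pos[OF Q0 s2] by (intro divide_left_mono) auto
      finally have v: "\<bar>v n\<bar> \<le> \<bar>\<tau>\<bar> / (s / sqrt 2)" .
      have "norm ((u n - 1) * (P (of_real (r n) - l n) - poly p (r n)))
          \<le> (\<bar>A\<bar> / (s * sqrt (r n))) * (C * r n ^ k * (2 * (\<bar>\<tau>\<bar> / (s / sqrt 2))))"
        unfolding norm_mult
      proof (rule mult_mono)
        have "A / (s * sqrt (r n)) \<le> \<bar>A\<bar> / (s * sqrt (r n))"
          using s elim by (intro divide_right_mono) auto
        thus "norm (u n - 1) \<le> \<bar>A\<bar> / (s * sqrt (r n))" using elim(1) unfolding sq by (rule order_trans[rotated])
        have "norm (P (of_real (r n) - l n) - poly p (r n)) \<le> C * r n ^ k * norm (l n)"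
          unfolding l_def using elim by (intro C(2)) auto
        also have "\<dots> \<le> C * r n ^ k * (2 * (\<bar>\<tau>\<bar> / (s / sqrt 2)))"
          using elim C(1) v by (intro mult_left_mono) auto
        finally show "norm (P (of_real (r n) - l n) - poly p (r n)) \<le> C * r n ^ k * (2 * (\<bar>\<tau>\<bar> / (s / sqrt 2)))" .
      qed (use s elim in auto)
      also have "\<dots> = (\<bar>A\<bar> * C * 2 * sqrt 2 * \<bar>\<tau>\<bar>) * inverse (sqrt (r n))"
        using s(1) elim by (simp add: field_simps flip: s(2))
      finally show ?case .
    qed
    show "((\<lambda>n. (\<bar>A\<bar> * C * 2 * sqrt 2 * \<bar>\<tau>\<bar>) * inverse (sqrt (r n))) \<longlongrightarrow> 0) F"
      by (rule tendsto_mult_right_zero[OF rsinv])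
  qed
  \<comment> \<open>Here \<open>r^(k-1) * v^2\<close> is of order \<open>1 / r\<close>, since
    \<open>Q r * v^2 = \<tau>^2\<close> and \<open>Q r\<close> is at least
    \<open>r^k / 2\<close>.\<close>
  have T3: "((\<lambda>n. P (of_real (r n) - l n) - poly p (r n) + Q (r n) * l n) \<longlongrightarrow> 0) F"
  proof (rule Lim_null_comparison)
    show "eventually (\<lambda>n. norm (P (of_real (r n) - l n) - poly p (r n) + Q (r n) * l n)
             \<le> (C * 8 * \<tau> ^ 2) * inverse (r n)) F"
      using z1 l_le r1 Qr Qv2
    proof eventually_elim
      case (elim n)
      have "norm (P (of_real (r n) - l n) - poly p (r n) + Q (r n) * l n)
            \<le> C * r n ^ (k - 1) * norm (l n) ^ 2"
        unfolding l_def using elim by (intro C(3)) auto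
      also have "\<dots> \<le> C * r n ^ (k - 1) * (2 * \<bar>v n\<bar>) ^ 2"
        using elim C(1) by (intro mult_left_mono power_mono) auto
      also have "\<dots> = C * 8 * ((r n ^ k / 2) * v n ^ 2) * inverse (r n)"
        using k_pos elim by (cases k) (auto simp: power_mult_distrib field_simps)
      also have "\<dots> \<le> C * 8 * (Q (r n) * v n ^ 2) * inverse (r n)"
        using elim C(1) by (intro mult_left_mono mult_right_mono) auto
      also have "\<dots> = (C * 8 * \<tau> ^ 2) * inverse (r n)" using elim by simp
      finally show ?case .
    qed
    show "((\<lambda>n. (C * 8 * \<tau> ^ 2) * inverse (r n)) \<longlongrightarrow> 0) F"
      by (rule tendsto_mult_right_zero[OF rinv])
  qed
  \<comment> \<open>The saddle point equation makes the terms linear in \<open>v\<close> cancel, and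
    \<open>- Q r * v^2 / 2 = - \<tau>^2 / 2\<close> is left.\<close>
  have T4: "((\<lambda>n. \<i> * of_real (Q (r n) * v n) - Q (r n) * l n) \<longlongrightarrow> - of_real (\<tau> ^ 2 / 2)) F"
  proof (cases "\<tau> = 0")
    case True
    thus ?thesis by (simp add: v_def l_def)
  next
    case False
    have "eventually (\<lambda>n. Q (r n) > 0) F" using Qtop by (simp add: filterlim_at_top_dense)
    hence v_ne: "eventually (\<lambda>n. v n \<noteq> 0) F"
      by eventually_elim (use False in \<open>auto simp: v_def\<close>)
    have vat: "filterlim v (at 0) F"
      unfolding filterlim_at using v0 v_ne by simp
    define a where "a = (\<lambda>n. ln (1 + v n ^ 2) / v n ^ 2)"
    define b where "b = (\<lambda>n. (v n - arctan (v n)) / v n ^ 2)"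
    have ab: "(a \<longlongrightarrow> 1) F" "(b \<longlongrightarrow> 0) F"
      unfolding a_def b_def
      by (rule filterlim_compose[OF tendsto_ln_over_square vat]
               filterlim_compose[OF tendsto_arctan_over_square vat])+
    have "((\<lambda>n. of_real (\<tau> ^ 2) * (of_real (- (a n / 2)) + \<i> * of_real (b n)))
            \<longlongrightarrow> of_real (\<tau> ^ 2) * (of_real (- (1 / 2)) + \<i> * of_real 0)) F"
      by (intro tendsto_intros ab) auto
    moreover have "eventually (\<lambda>n. of_real (\<tau> ^ 2) * (of_real (- (a n / 2)) + \<i> * of_real (b n))
         = \<i> * of_real (Q (r n) * v n) - Q (r n) * l n) F"
      using Qv2 v_ne
    proof eventually_elim
      case (elim n)
      have a: "\<tau> ^ 2 * a n = Q (r n) * ln (1 + v n ^ 2)"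
        using elim by (simp add: a_def flip: elim(1))
      have b: "\<tau> ^ 2 * b n = Q (r n) * (v n - arctan (v n))"
        using elim by (simp add: b_def flip: elim(1))
      have l: "l n = of_real (ln (1 + v n ^ 2) / 2) + \<i> * of_real (arctan (v n))"
        by (rule complex_eqI) (simp_all add: l_def Re_Ln_one_plus_i Im_Ln_one_plus_i)
      have "of_real (\<tau> ^ 2) * (of_real (- (a n / 2)) + \<i> * of_real (b n))
            = of_real (- (\<tau> ^ 2 * a n) / 2) + \<i> * of_real (\<tau> ^ 2 * b n)"
        by (simp add: algebra_simps)
      thus ?case unfolding a b l by (simp add: algebra_simps)
    qed
    ultimately show ?thesis by (simp add: tendsto_cong)
  qed
  have "((\<lambda>n. exp (u n * (G (exp (- w n)) - P (- Ln (w n))) +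
        (u n - 1) * (P (of_real (r n) - l n) - poly p (r n)) +
        (P (of_real (r n) - l n) - poly p (r n) + Q (r n) * l n) +
        (\<i> * of_real (Q (r n) * v n) - Q (r n) * l n))) \<longlongrightarrow> exp (1 * 0 + 0 + 0 + - of_real (\<tau> ^ 2 / 2))) F"
    by (intro tendsto_exp tendsto_add T1 T2 T3 T4)
  also have "(\<lambda>n. exp (u n * (G (exp (- w n)) - P (- Ln (w n))) +
        (u n - 1) * (P (of_real (r n) - l n) - poly p (r n)) +
        (P (of_real (r n) - l n) - poly p (r n) + Q (r n) * l n) +
        (\<i> * of_real (Q (r n) * v n) - Q (r n) * l n))) = (\<lambda>n. integrand (r n) (u n) \<tau>)"
  proof
    fix n
    have "- Ln (w n) = of_real (r n) - l n" unfolding w_def l_def by (rule minus_Ln_scaled)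
    moreover have "integrand (r n) (u n) \<tau> =
        exp (u n * (G (exp (- w n)) - of_real (poly p (r n))) + \<i> * of_real (Q (r n) * v n))"
      by (simp only: integrand_def w_def v_def)
    ultimately show "exp (u n * (G (exp (- w n)) - P (- Ln (w n))) +
        (u n - 1) * (P (of_real (r n) - l n) - poly p (r n)) +
        (P (of_real (r n) - l n) - poly p (r n) + Q (r n) * l n) +
        (\<i> * of_real (Q (r n) * v n) - Q (r n) * l n)) = integrand (r n) (u n) \<tau>"
      by (simp add: algebra_simps)
  qed
  finally show ?thesis by simp
qed

text \<open>While \<open>w\<close> stays near 0, replacing \<open>G\<close> by \<open>P\<close>
  costs a bounded factor \<open>exp M\<close>; the rest is covered by
  \<open>exp_P_dominated\<close>.\<close>

lemma integrand_dominated: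
  assumes "A \<ge> 0"
  obtains \<epsilon> R c K where "\<epsilon> > 0" "\<epsilon> < 1" "c > 0" "K > 0"
    "\<And>r u \<tau>. R \<le> r \<Longrightarrow> norm (u - 1) \<le> A / sqrt (r ^ Suc k) \<Longrightarrow> \<bar>exp (- r) / sqrt (Q r) * \<tau>\<bar> \<le> \<epsilon> \<Longrightarrow>
       norm (integrand r u \<tau>) \<le> K / (1 + c * \<tau> ^ 2)"
proof -
  obtain \<delta> B where B: "\<delta> > 0" "B \<ge> 0"
    "\<And>w. w \<noteq> 0 \<Longrightarrow> 0 \<le> Re w \<Longrightarrow> norm w < \<delta> \<Longrightarrow> norm (G (exp (- w)) - P (- Ln w)) \<le> B * norm w"
    using expansion_bound by blast
  obtain R c K where R: "R \<ge> 1" "c > 0" "K > 0"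
    "\<And>r \<tau> u. R \<le> r - ln (1 + (\<tau> / sqrt (Q r)) ^ 2) / 2 \<Longrightarrow> norm (u - 1) \<le> A / sqrt (r ^ Suc k) \<Longrightarrow>
       norm (exp (u * (P (of_real r - Ln (1 + \<i> * of_real (\<tau> / sqrt (Q r)))) - poly p r)))
         \<le> K / (1 + c * \<tau> ^ 2)"
    using exp_P_dominated[OF assms] by blast
  \<comment> \<open>Both \<open>exp (- r)\<close> and the imaginary part of \<open>w\<close> will be
    at most \<open>\<epsilon>\<close>, so \<open>norm w \<le> 2 * \<epsilon>\<close>. This must lie
    below \<open>\<delta>\<close> for the expansion and below \<open>exp (- R)\<close> for the
    decay. The bound \<open>1 / 2\<close> keeps the window inside \<open>{-pi..pi}\<close>.\<close>
  define \<epsilon> where "\<epsilon> = min (min (\<delta> / 3) (exp (- R) / 3)) (1 / 2)"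
  have "\<epsilon> > 0" "\<epsilon> \<le> \<delta> / 3" "\<epsilon> \<le> exp (- R) / 3" "\<epsilon> \<le> 1 / 2"
    using B(1) by (auto simp: \<epsilon>_def)
  moreover have "exp (- R) > 0" by simp
  ultimately have \<epsilon>: "\<epsilon> > 0" "\<epsilon> < 1" "2 * \<epsilon> < \<delta>" "2 * \<epsilon> \<le> exp (- R)"
    using B(1) by linarith+
  define R' where "R' = max 1 (- ln \<epsilon>)"
  define M where "M = (1 + A) * (B * \<delta>)"
  show ?thesis
  proof
    show "\<epsilon> > 0" "\<epsilon> < 1" "c > 0" by fact+
    show "exp M * K > 0" using R by simp
    fix r \<tau> :: real and u :: complex
    assume r: "R' \<le> r" and u: "norm (u - 1) \<le> A / sqrt (r ^ Suc k)"
      and \<tau>: "\<bar>exp (- r) / sqrt (Q r) * \<tau>\<bar> \<le> \<epsilon>"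
    define v where "v = \<tau> / sqrt (Q r)"
    define w where "w = of_real (exp (- r)) * (1 + \<i> * of_real v)"
    have r1: "1 \<le> r" "- ln \<epsilon> \<le> r" using r by (auto simp: R'_def)
    have w1: "norm w \<le> exp (- r) + \<bar>exp (- r) * v\<bar>"
      unfolding w_def ring_distribs
      by (rule order_trans[OF norm_triangle_ineq]) (simp add: norm_mult abs_mult)
    have w2: "exp (- r) \<le> \<epsilon>" using r1 \<epsilon>(1) by (metis exp_ln exp_le_cancel_iff minus_le_iff)
    have w3: "\<bar>exp (- r) * v\<bar> \<le> \<epsilon>" using \<tau> by (simp add: v_def)
    from w1 w2 w3 have w: "norm w \<le> 2 * \<epsilon>" by linarith
    have w_ne: "w \<noteq> 0" "0 \<le> Re w" by (auto simp: w_def complex_eq_iff)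
    have "exp (- (r - ln (1 + v ^ 2) / 2)) \<le> exp (- R)"
      using w \<epsilon>(4) unfolding w_def norm_scaled by linarith
    hence z: "R \<le> r - ln (1 + v ^ 2) / 2" by simp
    have u1: "norm u \<le> 1 + A"
    proof -
      have "1 \<le> sqrt (r ^ Suc k)" using r1 by (simp del: power_Suc)
      hence "A / sqrt (r ^ Suc k) \<le> A / 1" using assms by (intro divide_left_mono) auto
      thus ?thesis using u norm_triangle_ineq[of 1 "u - 1"] by simp
    qed
    have "integrand r u \<tau> = exp (u * (G (exp (- w)) - P (- Ln w))) *
         exp (u * (P (of_real r - Ln (1 + \<i> * of_real v)) - poly p r)) * exp (\<i> * of_real (Q r * v))"
      unfolding integrand_def v_def[symmetric] w_def[symmetric] exp_add[symmetric]
      by (subst minus_Ln_scaled[of r v, folded w_def]) (simp add: algebra_simps)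
    hence "norm (integrand r u \<tau>) = norm (exp (u * (G (exp (- w)) - P (- Ln w)))) *
         norm (exp (u * (P (of_real r - Ln (1 + \<i> * of_real v)) - poly p r)))"
      by (simp add: norm_mult)
    also have "\<dots> \<le> exp M * (K / (1 + c * \<tau> ^ 2))"
    proof (rule mult_mono)
      have "norm (exp (u * (G (exp (- w)) - P (- Ln w)))) \<le> exp (norm (u * (G (exp (- w)) - P (- Ln w))))"
        by (rule norm_exp)
      also have "norm (u * (G (exp (- w)) - P (- Ln w))) \<le> (1 + A) * (B * \<delta>)"
        unfolding norm_mult
      proof (rule mult_mono)
        have "norm (G (exp (- w)) - P (- Ln w)) \<le> B * norm w" using w_ne w \<epsilon> by (intro B(3)) auto
        also have "\<dots> \<le> B * \<delta>" using B w \<epsilon> by (intro mult_left_mono) auto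
        finally show "norm (G (exp (- w)) - P (- Ln w)) \<le> B * \<delta>" .
      qed (use u1 assms in auto)
      finally show "norm (exp (u * (G (exp (- w)) - P (- Ln w)))) \<le> exp M" by (simp add: M_def)
      show "norm (exp (u * (P (of_real r - Ln (1 + \<i> * of_real v)) - poly p r))) \<le> K / (1 + c * \<tau> ^ 2)"
        using R(4)[OF z[unfolded v_def] u] unfolding v_def .
    qed auto
    finally show "norm (integrand r u \<tau>) \<le> exp M * K / (1 + c * \<tau> ^ 2)" by simp
  qed
qed

section \<open>The arc near 1, by dominated convergence\<close>

lemma integrable_inverse_quadratic:
  fixes c :: real assumes "c > 0"
  shows "integrable lborel (\<lambda>\<tau>. K / (1 + c * \<tau> ^ 2))"
proof -
  have "integrable lborel (\<lambda>x::real. inverse (1 + x ^ 2))"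
    using integrable_inverse_1_plus_square by (simp add: set_integrable_def)
  hence "integrable lborel (\<lambda>x::real. inverse (1 + (0 + sqrt c * x) ^ 2))"
    using assms by (intro lborel_integrable_real_affine) auto
  hence "integrable lborel (\<lambda>x::real. K * inverse (1 + (0 + sqrt c * x) ^ 2))" by simp
  thus ?thesis using assms by (simp add: power_mult_distrib divide_inverse)
qed

text \<open>The window \<open>\<bar>y\<bar> \<le> \<epsilon>\<close> is fixed in the angle
  \<open>y = exp (- r) / sqrt (Q r) * \<tau>\<close>, so in the variable \<open>\<tau>\<close> it
  expands to the whole line.\<close>

lemma near_integral_tendsto:
  assumes r: "filterlim r at_top sequentially" and A: "A \<ge> 0"
    and u: "eventually (\<lambda>n. norm (u n - 1) \<le> A / sqrt (r n ^ Suc k)) sequentially" "u \<longlonglongrightarrow> 1"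
  obtains \<epsilon> where "\<epsilon> > 0" "\<epsilon> < 1"
    "(\<lambda>n. \<integral>\<tau>. indicator {-\<epsilon>..\<epsilon>} (exp (- r n) / sqrt (Q (r n)) * \<tau>) *\<^sub>R integrand (r n) (u n) \<tau> \<partial>lborel)
       \<longlonglongrightarrow> (\<integral>\<tau>. exp (- of_real (\<tau> ^ 2 / 2)) \<partial>lborel)"
proof -
  obtain \<epsilon> R c K where D: "\<epsilon> > 0" "\<epsilon> < 1" "c > 0" "K > 0"
    "\<And>r u \<tau>. R \<le> r \<Longrightarrow> norm (u - 1) \<le> A / sqrt (r ^ Suc k) \<Longrightarrow> \<bar>exp (- r) / sqrt (Q r) * \<tau>\<bar> \<le> \<epsilon> \<Longrightarrow>
       norm (integrand r u \<tau>) \<le> K / (1 + c * \<tau> ^ 2)"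
    using integrand_dominated[OF A] by metis
  define g where "g = (\<lambda>n \<tau>. indicator {-\<epsilon>..\<epsilon>} (exp (- r n) / sqrt (Q (r n)) * \<tau>) *\<^sub>R integrand (r n) (u n) \<tau>)"
  have [measurable]: "g n \<in> borel_measurable lborel" for n
    unfolding g_def by measurable
  have "eventually (\<lambda>n. R \<le> r n) sequentially" using r by (simp add: filterlim_at_top)
  with u(1) have "eventually (\<lambda>n. \<forall>\<tau>. norm (g n \<tau>) \<le> K / (1 + c * \<tau> ^ 2)) sequentially"
  proof eventually_elim
    case (elim n)
    show ?case
    proof
      fix \<tau>
      show "norm (g n \<tau>) \<le> K / (1 + c * \<tau> ^ 2)"
      proof (cases "\<bar>exp (- r n) / sqrt (Q (r n)) * \<tau>\<bar> \<le> \<epsilon>")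
        case True
        hence "norm (integrand (r n) (u n) \<tau>) \<le> K / (1 + c * \<tau> ^ 2)" using elim by (intro D(5)) auto
        thus ?thesis using D by (auto simp: g_def indicator_def)
      next
        case False
        hence "g n \<tau> = 0" by (auto simp: g_def indicator_def abs_le_iff)
        thus ?thesis using D by (simp add: add_nonneg_nonneg)
      qed
    qed
  qed
  then obtain N where N: "\<And>n \<tau>. n \<ge> N \<Longrightarrow> norm (g n \<tau>) \<le> K / (1 + c * \<tau> ^ 2)"
    unfolding eventually_sequentially by blast
  have Qtop: "eventually (\<lambda>n. Q (r n) \<ge> 1) sequentially"
  proof -
    have "eventually (\<lambda>n. r n ^ k / 2 \<le> Q (r n) \<and> Q (r n) \<le> 2 * r n ^ k) sequentially"
      using Q_bounds r by (rule eventually_compose_filterlim)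
    moreover have "eventually (\<lambda>n. r n \<ge> 2) sequentially" using r by (simp add: filterlim_at_top)
    ultimately show ?thesis
    proof eventually_elim
      case (elim n)
      have "r n \<le> r n ^ k" using elim k_pos by (intro self_le_power) auto
      thus ?case using elim by linarith
    qed
  qed
  have ex0: "(\<lambda>n. exp (- r n)) \<longlonglongrightarrow> 0"
    using filterlim_compose[OF exp_at_bot, of "\<lambda>n. - r n"] r by (simp add: filterlim_uminus_at_top)
  have lim: "(\<lambda>n. g n \<tau>) \<longlonglongrightarrow> exp (- of_real (\<tau> ^ 2 / 2))" for \<tau>
  proof -
    have "eventually (\<lambda>n. exp (- r n) * \<bar>\<tau>\<bar> < \<epsilon>) sequentially"
      using tendsto_mult_left_zero[OF ex0, of "\<bar>\<tau>\<bar>"] D(1) by (rule order_tendstoD)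
    hence "eventually (\<lambda>n. integrand (r n) (u n) \<tau> = g n \<tau>) sequentially"
      using Qtop
    proof eventually_elim
      case (elim n)
      have "\<bar>exp (- r n) / sqrt (Q (r n)) * \<tau>\<bar> = exp (- r n) * \<bar>\<tau>\<bar> / sqrt (Q (r n))"
        using elim by (simp add: abs_mult)
      also have "\<dots> \<le> exp (- r n) * \<bar>\<tau>\<bar> / 1" using elim by (intro divide_left_mono) auto
      also have "\<dots> \<le> \<epsilon>" using elim by simp
      finally have "exp (- r n) / sqrt (Q (r n)) * \<tau> \<in> {-\<epsilon>..\<epsilon>}"
        unfolding abs_le_iff atLeastAtMost_iff by linarith
      thus ?case by (simp only: g_def indicator_simps scaleR_one)
    qed
    with integrand_tendsto[OF r u, of \<tau>] show ?thesis by (rule Lim_transform_eventually)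
  qed
  \<comment> \<open>The majorant is available from index \<open>N\<close> on only, whereas the
    convergence theorem asks for it at every index; hence the shift.\<close>
  have "(\<lambda>n. integral\<^sup>L lborel (g (n + N))) \<longlonglongrightarrow> integral\<^sup>L lborel (\<lambda>\<tau>::real. exp (- of_real (\<tau> ^ 2 / 2)) :: complex)"
  proof (rule integral_dominated_convergence)
    show "integrable lborel (\<lambda>\<tau>. K / (1 + c * \<tau> ^ 2))" by (rule integrable_inverse_quadratic[OF D(3)])
    show "AE \<tau> in lborel. (\<lambda>n. g (n + N) \<tau>) \<longlonglongrightarrow> exp (- of_real (\<tau> ^ 2 / 2))"
      using LIMSEQ_ignore_initial_segment[OF lim] by simp
    show "AE \<tau> in lborel. norm (g (n + N) \<tau>) \<le> K / (1 + c * \<tau> ^ 2)" for n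
      using N[of "n + N"] by simp
  qed auto
  hence "(\<lambda>n. integral\<^sup>L lborel (g n)) \<longlonglongrightarrow> integral\<^sup>L lborel (\<lambda>\<tau>::real. exp (- of_real (\<tau> ^ 2 / 2)) :: complex)"
    by (rule LIMSEQ_offset)
  thus ?thesis using D(1,2) by (intro that[of \<epsilon>]) (auto simp: g_def)
qed

section \<open>The arc away from 1 and the whole circle\<close>

text \<open>Compactness of two rectangles in the \<open>w\<close>-plane, on which
  \<open>exp (- w) \<noteq> 1\<close> because
  \<open>\<epsilon> \<le> \<bar>Im w\<bar> \<le> pi\<close>. The edge \<open>x = 0\<close> belongs
  to them, as the circles approach the unit circle; this uses the continuity of \<open>G\<close> up
  to the boundary.\<close>

lemma G_bounded_away_from_1:
  assumes "0 < \<epsilon>"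
  obtains B where "B \<ge> 0"
    "\<And>x y. 0 \<le> x \<Longrightarrow> x \<le> 1 \<Longrightarrow> \<epsilon> \<le> \<bar>y\<bar> \<Longrightarrow> \<bar>y\<bar> \<le> pi \<Longrightarrow>
       norm (G (exp (- (of_real x + \<i> * of_real y)))) \<le> B"
proof -
  define S where "S = cbox (Complex 0 \<epsilon>) (Complex 1 pi) \<union> cbox (Complex 0 (- pi)) (Complex 1 (- \<epsilon>))"
  have S: "w \<in> S \<longleftrightarrow> 0 \<le> Re w \<and> Re w \<le> 1 \<and> \<epsilon> \<le> \<bar>Im w\<bar> \<and> \<bar>Im w\<bar> \<le> pi" for w
    using assms by (auto simp: S_def in_cbox_complex_iff)
  have "compact S" unfolding S_def by (intro compact_Un compact_cbox)
  moreover have "continuous_on S (\<lambda>w. G (exp (- w)))"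
  proof (rule continuous_on_compose2[OF continuous_G])
    show "continuous_on S (\<lambda>w. exp (- w))" by (intro continuous_intros)
    show "(\<lambda>w. exp (- w)) ` S \<subseteq> cball 0 1 - {1}"
    proof
      fix t assume "t \<in> (\<lambda>w. exp (- w)) ` S"
      then obtain w where w: "w \<in> S" "t = exp (- w)" by blast
      have "norm t \<le> 1" using w by (simp add: S)
      moreover have "t \<noteq> 1"
      proof
        assume "t = 1"
        hence "exp (- w) = 1" using w by simp
        then obtain j :: int where j: "Im (- w) = of_int (2 * j) * pi" unfolding exp_eq_1 by blast
        hence "Im w = - (2 * real_of_int j * pi)" by simp
        hence "\<bar>Im w\<bar> = \<bar>2 * real_of_int j\<bar> * pi" by (simp add: abs_mult)
        hence "\<bar>2 * real_of_int j\<bar> * pi \<le> 1 * pi" using w(1) by (simp add: S)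
        hence "\<bar>2 * real_of_int j\<bar> \<le> 1" by (subst (asm) mult_le_cancel_right_pos) auto
        hence "j = 0" by linarith
        thus False using j w assms by (simp add: S)
      qed
      ultimately show "t \<in> cball 0 1 - {1}" by simp
    qed
  qed
  ultimately have "compact ((\<lambda>w. G (exp (- w))) ` S)" by (intro compact_continuous_image)
  then obtain B where B: "\<And>w. w \<in> S \<Longrightarrow> norm (G (exp (- w))) \<le> B"
    by (meson compact_imp_bounded bounded_iff imageI)
  show ?thesis
  proof
    show "max B 0 \<ge> 0" by simp
    fix x y :: real assume "0 \<le> x" "x \<le> 1" "\<epsilon> \<le> \<bar>y\<bar>" "\<bar>y\<bar> \<le> pi"
    hence "norm (G (exp (- (of_real x + \<i> * of_real y)))) \<le> B" by (intro B) (simp add: S)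
    thus "norm (G (exp (- (of_real x + \<i> * of_real y)))) \<le> max B 0" by simp
  qed
qed

text \<open>The factor \<open>sqrt (Q r) * exp r\<close> is the reciprocal width of the peak in the
  angle and is at most \<open>exp (2 * r)\<close> for large \<open>r\<close>. As
  \<open>poly p r\<close> has order \<open>r^(k+1)\<close> with \<open>k \<ge> 1\<close>, it exceeds
  \<open>6 * r\<close>, and \<open>exp (- 3 * r)\<close> wins.\<close>

lemma far_negligible:
  "((\<lambda>r. M * (exp (- poly p r / 2) * (sqrt (Q r) * exp r))) \<longlongrightarrow> 0) at_top"
proof (rule tendsto_mult_right_zero, rule Lim_null_comparison)
  have "eventually (\<lambda>r. poly p r / r ^ Suc k > 1 / (2 * real (Suc k))) at_top"
    by (rule order_tendstoD[OF p_asymp]) (simp add: field_simps)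
  moreover have "filterlim (\<lambda>r::real. r ^ k) at_top at_top"
    using k_pos by (intro filterlim_pow_at_top filterlim_ident) auto
  hence "eventually (\<lambda>r::real. r ^ k \<ge> 6 * (2 * real (Suc k))) at_top" by (simp add: filterlim_at_top)
  ultimately have p: "eventually (\<lambda>r. poly p r \<ge> 6 * r) at_top"
    using eventually_gt_at_top[of 0]
  proof eventually_elim
    case (elim r)
    have "6 * r \<le> r ^ k / (2 * real (Suc k)) * r"
      using elim by (intro mult_right_mono) (auto simp: field_simps)
    also have "\<dots> = (1 / (2 * real (Suc k))) * r ^ Suc k" by simp
    also have "\<dots> \<le> (poly p r / r ^ Suc k) * r ^ Suc k"
      using elim by (intro mult_right_mono) auto
    also have "\<dots> = poly p r" using elim by simp
    finally show ?case .
  qed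
  have "((\<lambda>r::real. r ^ k / exp r) \<longlongrightarrow> 0) at_top" by (rule tendsto_power_div_exp_0)
  hence "eventually (\<lambda>r::real. r ^ k / exp r < 1 / 2) at_top" by (rule order_tendstoD) simp
  with p Q_bounds eventually_ge_at_top[of 0]
  show "eventually (\<lambda>r. norm (exp (- poly p r / 2) * (sqrt (Q r) * exp r)) \<le> exp (- r)) at_top"
  proof eventually_elim
    case (elim r)
    have "0 \<le> r ^ k / 2" using elim by simp
    hence Q0: "0 \<le> Q r" using elim by linarith
    have "Q r \<le> exp r" using elim by (simp add: field_simps)
    also have "\<dots> \<le> exp r * exp r" using elim by simp
    finally have "sqrt (Q r) \<le> exp r" using real_sqrt_le_mono[of "Q r" "exp r * exp r"] by simp
    hence "exp (- poly p r / 2) * (sqrt (Q r) * exp r) \<le> exp (- (3 * r)) * (exp r * exp r)"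
      using elim by (intro mult_mono) auto
    also have "\<dots> = exp (- r)" by (simp flip: exp_add)
    finally show ?case using Q0 by simp
  qed
  show "((\<lambda>r::real. exp (- r)) \<longlongrightarrow> 0) at_top"
    using exp_at_bot filterlim_compose filterlim_uminus_at_bot_at_top by blast
qed

text \<open>The exponential normalisation is the reciprocal of the integrand's approximate size at
  \<open>y = 0\<close>, where \<open>G\<close> is about \<open>P r\<close> and
  \<open>n * exp (- r) = Q r\<close>. The last factor is the Jacobian of the passage from
  \<open>y\<close> to \<open>\<tau>\<close>.\<close>

lemma circle_integral_tendsto:
  assumes r: "filterlim r at_top sequentially" and A: "A \<ge> 0"
    and saddle: "eventually (\<lambda>n. exp (r n) * Q (r n) = real n) sequentially"
    and u: "eventually (\<lambda>n. norm (u n - 1) \<le> A / sqrt (r n ^ Suc k)) sequentially" "u \<longlonglongrightarrow> 1"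
  shows "(\<lambda>n. integral {- pi..pi} (\<lambda>y. exp (u n * G (exp (- (of_real (exp (- r n)) + \<i> * of_real y))))
                 * exp (of_nat n * (of_real (exp (- r n)) + \<i> * of_real y)))
            * exp (- (u n * of_real (poly p (r n)) + of_real (Q (r n)))) * of_real (sqrt (Q (r n)) * exp (r n)))
         \<longlonglongrightarrow> (\<integral>\<tau>. exp (- of_real (\<tau> ^ 2 / 2)) \<partial>lborel)" (is "?I \<longlonglongrightarrow> ?L")
proof -
  obtain \<epsilon> where \<epsilon>: "\<epsilon> > 0" "\<epsilon> < 1" and near:
    "(\<lambda>n. \<integral>\<tau>. indicator {-\<epsilon>..\<epsilon>} (exp (- r n) / sqrt (Q (r n)) * \<tau>) *\<^sub>R integrand (r n) (u n) \<tau> \<partial>lborel)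
       \<longlonglongrightarrow> ?L"
    using near_integral_tendsto[OF r A u] by blast
  obtain B where B: "B \<ge> 0"
    "\<And>x y. 0 \<le> x \<Longrightarrow> x \<le> 1 \<Longrightarrow> \<epsilon> \<le> \<bar>y\<bar> \<Longrightarrow> \<bar>y\<bar> \<le> pi \<Longrightarrow>
       norm (G (exp (- (of_real x + \<i> * of_real y)))) \<le> B"
    using G_bounded_away_from_1[OF \<epsilon>(1)] by blast
  \<comment> \<open>The normalised integrand in the angle \<open>y\<close>, before
    rescaling.\<close>
  define H where "H = (\<lambda>n y. exp (u n * (G (exp (- (of_real (exp (- r n)) + \<i> * of_real y))) - of_real (poly p (r n)))
        + \<i> * of_real (real n * y)))"
  define far where "far = (\<lambda>n. (LBINT y:{-pi..pi} - {-\<epsilon>..\<epsilon>}. H n y) * of_real (sqrt (Q (r n)) * exp (r n)))"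
  have contH: "continuous_on UNIV (H n)" for n
    unfolding H_def by (intro continuous_intros continuous_G_exp) auto
  have intH: "set_integrable lborel {a..b} (H n)" for a b n
    by (intro borel_integrable_atLeastAtMost' continuous_on_subset[OF contH]) auto
  have intH': "set_integrable lborel ({-pi..pi} - {-\<epsilon>..\<epsilon>}) (H n)" for n
    by (rule set_integrable_subset[OF intH[of "-pi" pi]]) auto
  have sub: "{-\<epsilon>..\<epsilon>} \<subseteq> {-pi..pi}" using \<epsilon> pi_gt3 by auto
  have Q1: "eventually (\<lambda>n. Q (r n) > 0 \<and> 2 \<le> r n) sequentially"
  proof -
    have "eventually (\<lambda>n. r n ^ k / 2 \<le> Q (r n) \<and> Q (r n) \<le> 2 * r n ^ k) sequentially"
      using Q_bounds r by (rule eventually_compose_filterlim)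
    moreover have "eventually (\<lambda>n. r n \<ge> 2) sequentially" using r by (simp add: filterlim_at_top)
    ultimately show ?thesis
    proof eventually_elim
      case (elim n)
      have "0 < r n ^ k / 2" using elim by simp
      thus ?case using elim by linarith
    qed
  qed
  have "far \<longlonglongrightarrow> 0"
  proof (rule Lim_null_comparison)
    \<comment> \<open>This forces \<open>Re u \<ge> 1 / 2\<close>, so the normalisation leaves a
      factor of at most \<open>exp (- poly p r / 2)\<close> on the far arc.\<close>
    have "eventually (\<lambda>n. norm (u n - 1) < 1 / 2) sequentially"
      using tendsto_norm_zero[OF tendsto_diff[OF u(2) tendsto_const[of 1], simplified]]
      by (rule order_tendstoD) simp
    moreover have "eventually (\<lambda>r. poly p r / r ^ Suc k > 0) at_top"
      by (rule order_tendstoD[OF p_asymp]) simp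
    hence "eventually (\<lambda>n. poly p (r n) / r n ^ Suc k > 0) sequentially"
      using r by (rule eventually_compose_filterlim)
    ultimately show "eventually (\<lambda>n. norm (far n) \<le> (2 * pi * exp (2 * B)) *
        (exp (- poly p (r n) / 2) * (sqrt (Q (r n)) * exp (r n)))) sequentially"
      using Q1
    proof eventually_elim
      case (elim n)
      have p0: "poly p (r n) \<ge> 0" using elim zero_less_power[of "r n" "Suc k"]
        by (auto simp: zero_less_divide_iff simp del: power_Suc)
      have u2: "norm (u n) \<le> 2" using elim norm_triangle_ineq[of 1 "u n - 1"] by simp
      have Reu: "Re (u n) \<ge> 1 / 2" using elim abs_Re_le_cmod[of "u n - 1"] by auto
      have bd: "norm (H n y) \<le> exp (2 * B) * exp (- poly p (r n) / 2)"
        if "y \<in> {-pi..pi} - {-\<epsilon>..\<epsilon>}" for y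
      proof -
        let ?g = "G (exp (- (of_real (exp (- r n)) + \<i> * of_real y)))"
        have "norm ?g \<le> B" using that elim by (intro B(2)) auto
        hence "norm (u n * ?g) \<le> 2 * B" unfolding norm_mult using u2 B by (intro mult_mono) auto
        hence "Re (u n * ?g) \<le> 2 * B" using complex_Re_le_cmod order_trans by blast
        moreover have "Re (u n) * poly p (r n) \<ge> 1 / 2 * poly p (r n)"
          using Reu p0 by (intro mult_right_mono) auto
        moreover have "Re (u n * (?g - of_real (poly p (r n))) + \<i> * of_real (real n * y)) = Re (u n * ?g) - Re (u n) * poly p (r n)"
          by (simp add: algebra_simps)
        ultimately have "Re (u n * (?g - of_real (poly p (r n))) + \<i> * of_real (real n * y)) \<le> 2 * B + (- poly p (r n) / 2)"
          by linarith
        thus ?thesis unfolding H_def norm_exp_eq_Re exp_add[symmetric] by simp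
      qed
      have "norm (LBINT y:{-pi..pi} - {-\<epsilon>..\<epsilon>}. H n y) \<le> (LBINT y:{-pi..pi} - {-\<epsilon>..\<epsilon>}. norm (H n y))"
        by (rule set_integral_norm_bound[OF intH'])
      also have "\<dots> \<le> (LBINT y:{-pi..pi}. exp (2 * B) * exp (- poly p (r n) / 2))"
        unfolding set_lebesgue_integral_def
      proof (rule integral_mono)
        show "integrable lborel (\<lambda>y. indicat_real ({-pi..pi} - {-\<epsilon>..\<epsilon>}) y *\<^sub>R norm (H n y))"
          using set_integrable_norm[OF intH'] by (simp add: set_integrable_def)
        show "integrable lborel (\<lambda>y. indicat_real {-pi..pi} y *\<^sub>R (exp (2 * B) * exp (- poly p (r n) / 2)))"
          using borel_integrable_atLeastAtMost'[of "-pi" pi "\<lambda>_. exp (2 * B) * exp (- poly p (r n) / 2)"]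
          by (simp add: set_integrable_def)
        fix y :: real
        show "indicat_real ({-pi..pi} - {-\<epsilon>..\<epsilon>}) y *\<^sub>R norm (H n y)
            \<le> indicat_real {-pi..pi} y *\<^sub>R (exp (2 * B) * exp (- poly p (r n) / 2))"
          using bd[of y] by (simp add: indicator_def)
      qed
      also have "\<dots> = 2 * pi * (exp (2 * B) * exp (- poly p (r n) / 2))"
        by (simp add: set_lebesgue_integral_def)
      finally have "norm (far n) \<le> 2 * pi * (exp (2 * B) * exp (- poly p (r n) / 2)) * (sqrt (Q (r n)) * exp (r n))"
        unfolding far_def norm_mult using elim by (intro mult_mono) (auto simp: abs_mult simp del: of_real_mult)
      thus ?case by (simp add: mult_ac)
    qed
    show "(\<lambda>n. (2 * pi * exp (2 * B)) *
        (exp (- poly p (r n) / 2) * (sqrt (Q (r n)) * exp (r n)))) \<longlonglongrightarrow> 0"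
      by (rule filterlim_compose[OF far_negligible r])
  qed
  from tendsto_add[OF near this]
  have "(\<lambda>n. (\<integral>\<tau>. indicator {-\<epsilon>..\<epsilon>} (exp (- r n) / sqrt (Q (r n)) * \<tau>) *\<^sub>R integrand (r n) (u n) \<tau> \<partial>lborel) + far n) \<longlonglongrightarrow> ?L"
    by simp
  moreover have "eventually (\<lambda>n. (\<integral>\<tau>. indicator {-\<epsilon>..\<epsilon>} (exp (- r n) / sqrt (Q (r n)) * \<tau>) *\<^sub>R integrand (r n) (u n) \<tau> \<partial>lborel) + far n = ?I n) sequentially"
    using Q1 saddle
  proof eventually_elim
    case (elim n)
    define x where "x = exp (- r n)"
    \<comment> \<open>The substitution is \<open>y = c * \<tau>\<close>; by \<open>nx\<close> it
      turns \<open>n * y\<close> into \<open>Q r * v\<close>.\<close>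
    define c where "c = x / sqrt (Q (r n))"
    have x: "x > 0" by (simp add: x_def)
    have c: "c > 0" using elim x by (simp add: c_def)
    have nx: "real n * x = Q (r n)" using elim(2) by (simp add: x_def exp_minus field_simps flip: elim(2))
    have cinv: "sqrt (Q (r n)) * exp (r n) = 1 / c" by (simp add: c_def x_def exp_minus field_simps)
    have Hc: "H n (0 + c * \<tau>) = integrand (r n) (u n) \<tau>" for \<tau>
    proof -
      have "real n * (c * \<tau>) = Q (r n) * (\<tau> / sqrt (Q (r n)))"
        by (simp add: c_def flip: nx)
      moreover have "of_real x + \<i> * of_real (c * \<tau>) = of_real x * (1 + \<i> * of_real (\<tau> / sqrt (Q (r n))))"
        by (simp add: c_def algebra_simps)
      ultimately show ?thesis unfolding H_def integrand_def x_def by simp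
    qed
    have "(LBINT y:{-\<epsilon>..\<epsilon>}. H n y) = \<bar>c\<bar> *\<^sub>R (\<integral>\<tau>. indicator {-\<epsilon>..\<epsilon>} (0 + c * \<tau>) *\<^sub>R H n (0 + c * \<tau>) \<partial>lborel)"
      unfolding set_lebesgue_integral_def using c by (intro lborel_integral_real_affine) auto
    hence near_eq: "(\<integral>\<tau>. indicator {-\<epsilon>..\<epsilon>} (exp (- r n) / sqrt (Q (r n)) * \<tau>) *\<^sub>R integrand (r n) (u n) \<tau> \<partial>lborel)
        = (LBINT y:{-\<epsilon>..\<epsilon>}. H n y) * of_real (sqrt (Q (r n)) * exp (r n))"
      unfolding cinv Hc using c by (simp add: scaleR_conv_of_real x_def[symmetric] c_def[symmetric])
    have "(LBINT y:{-pi..pi}. H n y) = (LBINT y:{-\<epsilon>..\<epsilon>} \<union> ({-pi..pi} - {-\<epsilon>..\<epsilon>}). H n y)"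
      using sub by (simp add: Un_absorb1 Un_Diff_cancel)
    also have "\<dots> = (LBINT y:{-\<epsilon>..\<epsilon>}. H n y) + (LBINT y:{-pi..pi} - {-\<epsilon>..\<epsilon>}. H n y)"
      by (intro set_integral_Un intH intH') auto
    finally have split: "(LBINT y:{-pi..pi}. H n y) = (LBINT y:{-\<epsilon>..\<epsilon>}. H n y) + (LBINT y:{-pi..pi} - {-\<epsilon>..\<epsilon>}. H n y)" .
    have Heq: "H n = (\<lambda>y. exp (u n * G (exp (- (of_real (exp (- r n)) + \<i> * of_real y))))
                 * exp (of_nat n * (of_real (exp (- r n)) + \<i> * of_real y)) *
                 exp (- (u n * of_real (poly p (r n)) + of_real (Q (r n)))))"
    proof
      fix y
      have "of_nat n * (of_real (exp (- r n)) + \<i> * of_real y) = of_real (Q (r n)) + \<i> * of_real (real n * y)"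
        by (simp add: algebra_simps x_def flip: nx)
      thus "H n y = exp (u n * G (exp (- (of_real (exp (- r n)) + \<i> * of_real y))))
                 * exp (of_nat n * (of_real (exp (- r n)) + \<i> * of_real y)) *
                 exp (- (u n * of_real (poly p (r n)) + of_real (Q (r n))))"
        unfolding H_def by (simp add: algebra_simps flip: exp_add)
    qed
    have "integral {-pi..pi} (H n) = integral {-pi..pi} (\<lambda>y. exp (u n * G (exp (- (of_real (exp (- r n)) + \<i> * of_real y))))
                 * exp (of_nat n * (of_real (exp (- r n)) + \<i> * of_real y))) *
                 exp (- (u n * of_real (poly p (r n)) + of_real (Q (r n))))"
      unfolding Heq by (rule integral_mult_left)
    moreover have "(LBINT y:{-pi..pi}. H n y) = integral {-pi..pi} (H n)"
      by (rule set_borel_integral_eq_integral(2)[OF intH])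
    ultimately have "?I n = (LBINT y:{-pi..pi}. H n y) * of_real (sqrt (Q (r n)) * exp (r n))" by (simp only:)
    thus ?case unfolding near_eq far_def split by (simp add: algebra_simps)
  qed
  ultimately show ?thesis by (rule Lim_transform_eventually)
qed

section \<open>Existence and size of the saddle point\<close>

text \<open>The equation is stationarity of \<open>P (- Ln w) + n * w\<close> at
  \<open>w = exp (- r)\<close>. Solutions exist for large \<open>n\<close> by the intermediate value
  theorem; for the other \<open>n\<close> the chosen value is arbitrary.\<close>

lemma saddle_points:
  obtains r :: "nat \<Rightarrow> real" where "filterlim r at_top sequentially"
    "eventually (\<lambda>n. exp (r n) * Q (r n) = real n) sequentially"
proof -
  obtain R0 where R0: "\<And>r. R0 \<le> r \<Longrightarrow> r ^ k / 2 \<le> Q r \<and> Q r \<le> 2 * r ^ k"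
    using Q_bounds by (auto simp: eventually_at_top_linorder)
  define R where "R = max R0 2"
  define h where "h = (\<lambda>r. exp r * Q r)"
  have cont: "continuous_on S h" for S unfolding h_def by (intro continuous_intros)
  have h_ge: "exp r \<le> h r" if "R \<le> r" for r
  proof -
    have "2 \<le> r" "R0 \<le> r" using that by (auto simp: R_def)
    moreover have "r \<le> r ^ k" using \<open>2 \<le> r\<close> k_pos by (intro self_le_power) auto
    ultimately have "1 \<le> Q r" using R0[of r] by linarith
    hence "exp r * 1 \<le> exp r * Q r" by (intro mult_left_mono) auto
    thus ?thesis by (simp add: h_def)
  qed
  have ex: "\<exists>r\<ge>R. h r = real n" if "h R \<le> real n" for n
  proof -
    define b where "b = max R (real n)"
    have "real n \<le> b" by (simp add: b_def)
    also have "b \<le> exp b" using exp_ge_add_one_self[of b] by linarith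
    also have "\<dots> \<le> h b" by (rule h_ge) (simp add: b_def)
    finally have "\<exists>r\<ge>R. r \<le> b \<and> h r = real n"
      using that cont by (intro IVT') (auto simp: b_def)
    thus ?thesis by blast
  qed
  define r where "r = (\<lambda>n. SOME r. R \<le> r \<and> h r = real n)"
  have ev: "eventually (\<lambda>n. h R \<le> real n) sequentially"
    using filterlim_real_sequentially by (simp add: filterlim_at_top)
  have r: "R \<le> r n \<and> h (r n) = real n" if "h R \<le> real n" for n
    unfolding r_def by (rule someI_ex) (use ex[OF that] in blast)
  show ?thesis
  proof (rule that[of r])
    show "eventually (\<lambda>n. exp (r n) * Q (r n) = real n) sequentially"
      using ev by eventually_elim (use r in \<open>simp add: h_def\<close>)
    show "filterlim r at_top sequentially"
      unfolding filterlim_at_top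
    proof
      fix Z
      \<comment> \<open>Divergence of \<open>r\<close>: on each bounded interval \<open>h\<close> is
        bounded, so solutions of \<open>h r = n\<close> leave it as \<open>n\<close> grows.\<close>
      have "compact (h ` {R..Z})" by (intro compact_continuous_image cont) auto
      then obtain M where M: "\<And>x. x \<in> {R..Z} \<Longrightarrow> \<bar>h x\<bar> \<le> M"
        by (metis compact_imp_bounded bounded_iff imageI real_norm_def)
      have "eventually (\<lambda>n. M + 1 \<le> real n) sequentially"
        using filterlim_real_sequentially unfolding filterlim_at_top by blast
      with ev show "eventually (\<lambda>n. Z \<le> r n) sequentially"
      proof eventually_elim
        case (elim n)
        show ?case
        proof (rule ccontr)
          assume "\<not> Z \<le> r n"
          hence "\<bar>h (r n)\<bar> \<le> M" using r[OF elim(1)] by (intro M) auto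
          thus False using r[OF elim(1)] elim(2) by simp
        qed
      qed
    qed
  qed
qed

text \<open>Taking logarithms, \<open>ln n = r + ln (Q r)\<close> with
  \<open>0 \<le> ln (Q r) \<le> ln 2 + k * ln r\<close>. The inequality turns bounds in terms of
  \<open>\<sigma>\<close> into bounds in terms of \<open>r\<close>; the limit exchanges the leading
  powers.\<close>

lemma saddle_point_asymp:
  assumes r: "filterlim r at_top sequentially"
    and saddle: "eventually (\<lambda>n. exp (r n) * Q (r n) = real n) sequentially"
  shows "eventually (\<lambda>n. r n \<le> ln (real n)) sequentially" "(\<lambda>n. ln (real n) / r n) \<longlonglongrightarrow> 1"
proof -
  have Qr: "eventually (\<lambda>n. r n ^ k / 2 \<le> Q (r n) \<and> Q (r n) \<le> 2 * r n ^ k) sequentially"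
    using Q_bounds r by (rule eventually_compose_filterlim)
  have r2: "eventually (\<lambda>n. r n \<ge> 2) sequentially" using r by (simp add: filterlim_at_top)
  have *: "eventually (\<lambda>n. 1 \<le> Q (r n) \<and> ln (real n) = r n + ln (Q (r n)) \<and> Q (r n) \<le> 2 * r n ^ k \<and> r n \<ge> 2) sequentially"
    using Qr r2 saddle
  proof eventually_elim
    case (elim n)
    have "r n \<le> r n ^ k" using elim k_pos by (intro self_le_power) auto
    hence Q: "1 \<le> Q (r n)" using elim by linarith
    have "ln (real n) = ln (exp (r n) * Q (r n))" using elim by simp
    also have "\<dots> = r n + ln (Q (r n))" using Q by (simp add: ln_mult)
    finally show ?case using Q elim by simp
  qed
  show "eventually (\<lambda>n. r n \<le> ln (real n)) sequentially"
    using * by eventually_elim auto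
  have lim: "((\<lambda>x::real. 1 + (ln 2 + real k * ln x) / x) \<longlongrightarrow> 1) at_top" by real_asymp
  show "(\<lambda>n. ln (real n) / r n) \<longlonglongrightarrow> 1"
  proof (rule tendsto_sandwich)
    show "eventually (\<lambda>n. 1 \<le> ln (real n) / r n) sequentially"
      using * by eventually_elim (auto simp: field_simps)
    show "eventually (\<lambda>n. ln (real n) / r n \<le> 1 + (ln 2 + real k * ln (r n)) / r n) sequentially"
      using *
    proof eventually_elim
      case (elim n)
      have "ln (Q (r n)) \<le> ln (2 * r n ^ k)" using elim by (intro ln_mono) auto
      also have "\<dots> = ln 2 + real k * ln (r n)" using elim by (simp add: ln_mult ln_realpow)
      finally have "ln (Q (r n)) / r n \<le> (ln 2 + real k * ln (r n)) / r n"
        using elim by (intro divide_right_mono) auto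
      thus ?case using elim by (simp add: add_divide_distrib)
    qed
    show "(\<lambda>n. 1 + (ln 2 + real k * ln (r n)) / r n) \<longlonglongrightarrow> 1"
      by (rule filterlim_compose[OF lim r])
  qed auto
qed

section \<open>Ratios of coefficients and exponential moments\<close>

text \<open>Both coefficients are integrals over the same circle with the same nonzero limit, so the
  Jacobian and \<open>exp (Q r)\<close> cancel and \<open>exp ((u - 1) * P r)\<close> is what
  remains of the normalisations.\<close>

lemma coefficient_ratio_tendsto:
  assumes holg: "g holomorphic_on ball 0 1" and gG: "\<And>t. t \<in> ball 0 1 \<Longrightarrow> G t = g t"
    and r: "filterlim r at_top sequentially" and A: "A \<ge> 0"
    and saddle: "eventually (\<lambda>n. exp (r n) * Q (r n) = real n) sequentially"
    and u: "eventually (\<lambda>n. norm (u n - 1) \<le> A / sqrt (r n ^ Suc k)) sequentially" "u \<longlonglongrightarrow> 1"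
  defines "a \<equiv> \<lambda>v n. (deriv ^^ n) (\<lambda>z. exp (v * g z)) 0 / fact n"
  shows "eventually (\<lambda>n. a 1 n \<noteq> 0) sequentially"
    and "(\<lambda>n. a (u n) n / a 1 n * exp (- ((u n - 1) * of_real (poly p (r n))))) \<longlonglongrightarrow> 1"
proof -
  define I where "I = (\<lambda>v n. integral {- pi..pi} (\<lambda>y. exp (v * G (exp (- (of_real (exp (- r n)) + \<i> * of_real y))))
                 * exp (of_nat n * (of_real (exp (- r n)) + \<i> * of_real y))))"
  define L where "L = (\<integral>\<tau>. exp (- of_real (\<tau> ^ 2 / 2) :: complex) \<partial>lborel)"
  have L: "L \<noteq> 0" unfolding L_def by (rule gaussian_integral_nonzero)
  have Ia: "I v n = 2 * pi * a v n" for v n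
  proof -
    have "((\<lambda>y. exp (v * g (exp (- (of_real (exp (- r n)) + \<i> * of_real y))))
                 * exp (of_nat n * (of_real (exp (- r n)) + \<i> * of_real y)))
        has_integral 2 * pi * a v n) {- pi..pi}"
      unfolding a_def by (intro has_integral_coeff_circle holomorphic_intros holg) auto
    hence "((\<lambda>y. exp (v * G (exp (- (of_real (exp (- r n)) + \<i> * of_real y))))
                 * exp (of_nat n * (of_real (exp (- r n)) + \<i> * of_real y)))
        has_integral 2 * pi * a v n) {- pi..pi}"
      by (subst gG) simp_all
    thus ?thesis unfolding I_def by (rule integral_unique)
  qed
  have u1: "(\<lambda>n. I (u n) n * exp (- (u n * of_real (poly p (r n)) + of_real (Q (r n)))) * of_real (sqrt (Q (r n)) * exp (r n))) \<longlonglongrightarrow> L"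
    unfolding I_def L_def by (rule circle_integral_tendsto[OF r A saddle u])
  \<comment> \<open>The constant sequence 1 is the case \<open>A = 0\<close>.\<close>
  have "(\<lambda>n. I ((\<lambda>_. 1) n) n * exp (- ((\<lambda>_. 1) n * of_real (poly p (r n)) + of_real (Q (r n)))) * of_real (sqrt (Q (r n)) * exp (r n))) \<longlonglongrightarrow> L"
    unfolding I_def L_def by (rule circle_integral_tendsto[OF r order.refl saddle]) auto
  hence one: "(\<lambda>n. I 1 n * exp (- (of_real (poly p (r n)) + of_real (Q (r n)))) * of_real (sqrt (Q (r n)) * exp (r n))) \<longlonglongrightarrow> L"
    by simp
  have ne: "eventually (\<lambda>n. I 1 n * exp (- (of_real (poly p (r n)) + of_real (Q (r n)))) * of_real (sqrt (Q (r n)) * exp (r n)) \<noteq> 0) sequentially"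
    using tendsto_imp_eventually_ne[OF one L] .
  thus "eventually (\<lambda>n. a 1 n \<noteq> 0) sequentially"
    by eventually_elim (auto simp: Ia)
  have "(\<lambda>n. (I (u n) n * exp (- (u n * of_real (poly p (r n)) + of_real (Q (r n)))) * of_real (sqrt (Q (r n)) * exp (r n)))
      / (I 1 n * exp (- (of_real (poly p (r n)) + of_real (Q (r n)))) * of_real (sqrt (Q (r n)) * exp (r n)))) \<longlonglongrightarrow> L / L"
    by (intro tendsto_divide u1 one L)
  moreover have "eventually (\<lambda>n. (I (u n) n * exp (- (u n * of_real (poly p (r n)) + of_real (Q (r n)))) * of_real (sqrt (Q (r n)) * exp (r n)))
      / (I 1 n * exp (- (of_real (poly p (r n)) + of_real (Q (r n)))) * of_real (sqrt (Q (r n)) * exp (r n)))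
      = a (u n) n / a 1 n * exp (- ((u n - 1) * of_real (poly p (r n))))) sequentially"
    using ne
  proof eventually_elim
    case (elim n)
    have "exp (- (u n * of_real (poly p (r n)) + of_real (Q (r n)))) =
       exp (- ((u n - 1) * of_real (poly p (r n)))) * exp (- (of_real (poly p (r n)) + of_real (Q (r n))))"
      by (simp add: algebra_simps flip: exp_add)
    thus ?case using elim by (simp add: Ia)
  qed
  ultimately show "(\<lambda>n. a (u n) n / a 1 n * exp (- ((u n - 1) * of_real (poly p (r n))))) \<longlonglongrightarrow> 1"
    using L by (simp add: tendsto_cong)
qed

text \<open>With \<open>z = s / \<sigma>\<close> and \<open>u = exp z\<close>, the ratio behaves
  like \<open>exp ((u - 1) * P r)\<close>. Centring leaves
  \<open>exp ((exp z - 1 - z) * P r)\<close>, whose exponent is about \<open>z^2 / 2 * P r\<close>,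
  and \<open>P r\<close> is asymptotic to \<open>\<sigma>^2\<close>.\<close>

lemma exponential_moment_tendsto:
  assumes holg: "g holomorphic_on ball 0 1" and gG: "\<And>t. t \<in> ball 0 1 \<Longrightarrow> G t = g t"
    and r: "filterlim r at_top sequentially"
    and saddle: "eventually (\<lambda>n. exp (r n) * Q (r n) = real n) sequentially"
  defines "a \<equiv> \<lambda>v n. (deriv ^^ n) (\<lambda>z. exp (v * g z)) 0 / fact n"
    and "\<sigma> \<equiv> \<lambda>n. sqrt (ln (real n) ^ (k + 1) / real (k + 1))"
  shows "eventually (\<lambda>n. a 1 n \<noteq> 0) sequentially"
    and "filterlim \<sigma> at_top sequentially"
    and "(\<lambda>n. poly p (r n) / \<sigma> n ^ 2) \<longlonglongrightarrow> 1"
    and "(\<lambda>n. a (exp (s / of_real (\<sigma> n))) n / a 1 n * exp (- (s / of_real (\<sigma> n) * of_real (poly p (r n))))) \<longlonglongrightarrow> exp (s ^ 2 / 2)"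
proof -
  note rl = saddle_point_asymp[OF r saddle]
  show sig: "filterlim \<sigma> at_top sequentially"
    unfolding \<sigma>_def by real_asymp
  have sig_pos: "eventually (\<lambda>n. \<sigma> n > 0) sequentially"
    using sig by (simp add: filterlim_at_top_dense)
  have r1: "eventually (\<lambda>n. r n \<ge> 1) sequentially" using r by (simp add: filterlim_at_top)
  define z where "z = (\<lambda>n. s / of_real (\<sigma> n) :: complex)"
  define u where "u = (\<lambda>n. exp (z n))"
  \<comment> \<open>From \<open>norm (exp z - 1) \<le> 2 * norm z\<close> for small
    \<open>z\<close>, and \<open>\<sigma> \<ge> sqrt (r^(k+1) / (k+1))\<close>, which follows from
    \<open>r \<le> ln n\<close>.\<close>
  define A where "A = 2 * (norm s * sqrt (real (k + 1)))"
  have "(\<lambda>n. s * of_real (inverse (\<sigma> n))) \<longlonglongrightarrow> s * of_real 0"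
    by (intro tendsto_intros tendsto_inverse_0_at_top[OF sig])
  hence z0: "z \<longlonglongrightarrow> 0" by (simp add: z_def divide_inverse)
  have u1: "u \<longlonglongrightarrow> 1" unfolding u_def using tendsto_exp[OF z0] by simp
  have ubd: "eventually (\<lambda>n. norm (u n - 1) \<le> A / sqrt (r n ^ Suc k)) sequentially"
  proof -
    have "eventually (\<lambda>n. norm (z n) < 1 / 2) sequentially"
      using tendsto_norm_zero[OF z0] by (rule order_tendstoD) simp
    thus ?thesis using rl(1) r1 sig_pos
    proof eventually_elim
      case (elim n)
      have pos: "0 < sqrt (r n ^ Suc k) / sqrt (real (k + 1))" using elim by (simp del: power_Suc)
      have "sqrt (r n ^ Suc k) / sqrt (real (k + 1)) = sqrt (r n ^ Suc k / real (k + 1))"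
        by (simp only: real_sqrt_divide)
      also have "\<dots> \<le> \<sigma> n"
        unfolding \<sigma>_def Suc_eq_plus1 using elim
        by (intro real_sqrt_le_mono divide_right_mono power_mono) auto
      finally have \<sigma>: "sqrt (r n ^ Suc k) / sqrt (real (k + 1)) \<le> \<sigma> n" .
      have "norm (u n - 1) \<le> 3 / 2 * norm (z n)"
        unfolding u_def using elim by (intro norm_exp_bounds) auto
      also have "\<dots> \<le> 2 * norm (z n)" by simp
      also have "\<dots> = 2 * norm s / \<sigma> n" using elim by (simp add: z_def norm_divide)
      also have "\<dots> \<le> 2 * norm s / (sqrt (r n ^ Suc k) / sqrt (real (k + 1)))"
        using \<sigma> pos elim by (intro divide_left_mono mult_pos_pos) auto
      also have "\<dots> = A / sqrt (r n ^ Suc k)" by (simp add: A_def)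
      finally show ?case .
    qed
  qed
  have A: "A \<ge> 0" by (simp add: A_def)
  have ratio: "eventually (\<lambda>n. a 1 n \<noteq> 0) sequentially"
    "(\<lambda>n. a (u n) n / a 1 n * exp (- ((u n - 1) * of_real (poly p (r n))))) \<longlonglongrightarrow> 1"
    unfolding a_def by (rule coefficient_ratio_tendsto[OF holg gG r A saddle ubd u1]; assumption)+
  show "eventually (\<lambda>n. a 1 n \<noteq> 0) sequentially" by (rule ratio(1))
  have "(\<lambda>n. (poly p (r n) / r n ^ Suc k) * inverse (ln (real n) / r n) ^ Suc k * real (Suc k))
      \<longlonglongrightarrow> (1 / real (Suc k)) * inverse 1 ^ Suc k * real (Suc k)"
    by (intro tendsto_mult tendsto_power tendsto_inverse rl(2) tendsto_const filterlim_compose[OF p_asymp r]) auto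
  moreover have "eventually (\<lambda>n. (poly p (r n) / r n ^ Suc k) * inverse (ln (real n) / r n) ^ Suc k * real (Suc k)
      = poly p (r n) / \<sigma> n ^ 2) sequentially"
    using rl(1) r1
  proof eventually_elim
    case (elim n)
    have "\<sigma> n ^ 2 = ln (real n) ^ Suc k / real (Suc k)"
      using elim unfolding \<sigma>_def Suc_eq_plus1 by (intro real_sqrt_pow2) auto
    thus ?case using elim by (simp add: power_divide divide_inverse power_mult_distrib power_inverse mult_ac del: power_Suc)
  qed
  ultimately show p\<sigma>: "(\<lambda>n. poly p (r n) / \<sigma> n ^ 2) \<longlonglongrightarrow> 1"
    by (simp add: tendsto_cong)
  have expo: "(\<lambda>n. (u n - 1 - z n) * of_real (poly p (r n))) \<longlonglongrightarrow> s ^ 2 / 2"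
  proof (cases "s = 0")
    case True
    thus ?thesis by (simp add: u_def z_def)
  next
    case False
    have z_ne: "eventually (\<lambda>n. z n \<noteq> 0) sequentially"
      using sig_pos by eventually_elim (use False in \<open>auto simp: z_def\<close>)
    hence zat: "filterlim z (at 0) sequentially" unfolding filterlim_at using z0 by simp
    have "(\<lambda>n. (exp (z n) - 1 - z n) / z n ^ 2 * (s ^ 2 * of_real (poly p (r n) / \<sigma> n ^ 2)))
        \<longlonglongrightarrow> 1 / 2 * (s ^ 2 * of_real 1)"
      by (intro tendsto_mult tendsto_const tendsto_of_real p\<sigma> filterlim_compose[OF exp_second_order zat])
    moreover have "eventually (\<lambda>n. (exp (z n) - 1 - z n) / z n ^ 2 * (s ^ 2 * of_real (poly p (r n) / \<sigma> n ^ 2))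
        = (u n - 1 - z n) * of_real (poly p (r n))) sequentially"
      using z_ne sig_pos
    proof eventually_elim
      case (elim n)
      have "s ^ 2 * of_real (poly p (r n) / \<sigma> n ^ 2) = z n ^ 2 * of_real (poly p (r n))"
        by (simp add: z_def power_divide)
      thus ?case using elim by (simp add: u_def)
    qed
    ultimately show ?thesis by (simp add: tendsto_cong)
  qed
  have "(\<lambda>n. a (u n) n / a 1 n * exp (- ((u n - 1) * of_real (poly p (r n)))) *
      exp ((u n - 1 - z n) * of_real (poly p (r n)))) \<longlonglongrightarrow> 1 * exp (s ^ 2 / 2)"
    by (intro tendsto_mult tendsto_exp expo ratio(2))
  also have "(\<lambda>n. a (u n) n / a 1 n * exp (- ((u n - 1) * of_real (poly p (r n)))) *
      exp ((u n - 1 - z n) * of_real (poly p (r n)))) =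
      (\<lambda>n. a (exp (s / of_real (\<sigma> n))) n / a 1 n * exp (- (s / of_real (\<sigma> n) * of_real (poly p (r n)))))"
  proof
    fix n
    have "exp (- ((u n - 1) * of_real (poly p (r n)))) * exp ((u n - 1 - z n) * of_real (poly p (r n)))
       = exp (- (z n * of_real (poly p (r n))))"
      by (simp add: algebra_simps flip: exp_add)
    thus "a (u n) n / a 1 n * exp (- ((u n - 1) * of_real (poly p (r n)))) *
      exp ((u n - 1 - z n) * of_real (poly p (r n))) =
      a (exp (s / of_real (\<sigma> n))) n / a 1 n * exp (- (s / of_real (\<sigma> n) * of_real (poly p (r n))))"
      unfolding u_def z_def by (simp add: mult.assoc)
  qed
  finally show "(\<lambda>n. a (exp (s / of_real (\<sigma> n))) n / a 1 n * exp (- (s / of_real (\<sigma> n) * of_real (poly p (r n))))) \<longlonglongrightarrow> exp (s ^ 2 / 2)"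
    by simp
qed

end

section \<open>The limit law\<close>

lemma cycle_index_of_real:
  "cycle_index (\<lambda>m. of_real (a m)) n = (of_real (cycle_index a n) :: complex)"
proof (induction n rule: less_induct)
  case (less n)
  show ?case
  proof (cases n)
    case (Suc j)
    have "(\<Sum>m\<le>j. of_real (a (Suc m)) * cycle_index (\<lambda>m. of_real (a m)) (j - m))
        = (\<Sum>m\<le>j. of_real (a (Suc m)) * (of_real (cycle_index a (j - m)) :: complex))"
      using less Suc by (intro sum.cong) auto
    thus ?thesis using Suc by (simp del: of_nat_Suc)
  qed simp
qed

lemma weight_norm_eq_cycle_index: "weight_norm \<theta> n = cycle_index \<theta> n"
  unfolding weight_norm_def cycle_weight_def by (subst sum_cycle_weights) simp

lemma integral_weighted_perm_measure:
  fixes f :: "(nat \<Rightarrow> nat) \<Rightarrow> 'b :: {banach, second_countable_topology}"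
  assumes "\<And>m. 1 \<le> m \<Longrightarrow> 0 \<le> \<theta> m"
  shows "integral\<^sup>L (weighted_perm_measure \<theta> n) f =
    (\<Sum>\<sigma> | \<sigma> permutes {1..n}. (cycle_weight \<theta> n \<sigma> / (weight_norm \<theta> n * fact n)) *\<^sub>R f \<sigma>)"
proof -
  have w: "0 \<le> cycle_weight \<theta> n \<sigma>" for \<sigma>
    unfolding cycle_weight_def using assms by (intro prod_nonneg) auto
  have h: "0 \<le> weight_norm \<theta> n"
    unfolding weight_norm_def using w by (intro divide_nonneg_nonneg sum_nonneg) auto
  show ?thesis unfolding weighted_perm_measure_def
    using w h by (intro lebesgue_integral_point_measure_finite) (auto simp: finite_permutations)
qed

lemma integrable_weighted_perm_measure:
  fixes f :: "(nat \<Rightarrow> nat) \<Rightarrow> 'b :: {banach, second_countable_topology}"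
  shows "integrable (weighted_perm_measure \<theta> n) f"
  unfolding weighted_perm_measure_def
  by (intro integrable_point_measure_finite) (simp add: finite_permutations)

text \<open>The number of cycles is additive over lengths, so \<open>u^K\<close> multiplies each
  weight \<open>\<theta> m\<close> by \<open>u\<close>. Where the normalisation vanishes, both sides
  are 0: the measure is zero and division by 0 gives 0.\<close>

lemma total_cycles_generating_function:
  fixes u :: complex
  assumes "\<And>m. 1 \<le> m \<Longrightarrow> 0 \<le> \<theta> m"
  shows "(\<integral>\<sigma>. u ^ total_cycles n \<sigma> \<partial>weighted_perm_measure \<theta> n)
       = cycle_index (\<lambda>m. u * of_real (\<theta> m)) n / cycle_index (\<lambda>m. of_real (\<theta> m)) n"
proof -
  have "(\<integral>\<sigma>. u ^ total_cycles n \<sigma> \<partial>weighted_perm_measure \<theta> n)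
    = (\<Sum>\<sigma> | \<sigma> permutes {1..n}. of_real (cycle_weight \<theta> n \<sigma>) * u ^ total_cycles n \<sigma> / of_real (weight_norm \<theta> n * fact n))"
    by (subst integral_weighted_perm_measure[OF assms]) (auto simp: scaleR_conv_of_real intro!: sum.cong)
  also have "\<dots> = (\<Sum>\<sigma> | \<sigma> permutes {1..n}. \<Prod>m=1..n. (u * of_real (\<theta> m)) ^ num_cycles_of_length n m \<sigma>)
      / of_real (weight_norm \<theta> n * fact n)"
    unfolding sum_divide_distrib[symmetric] cycle_weight_def total_cycles_def of_real_prod power_sum
      prod.distrib[symmetric] by (simp add: power_mult_distrib mult.commute)
  also have "\<dots> = cycle_index (\<lambda>m. u * of_real (\<theta> m)) n / of_real (weight_norm \<theta> n)"
    by (subst sum_cycle_weights) simp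
  finally show ?thesis by (simp add: weight_norm_eq_cycle_index cycle_index_of_real)
qed

lemma standing_assumptionsE:
  assumes "standing_assumptions \<theta> k"
  obtains p G where "log_singularity p k G" "\<And>t. t \<in> ball 0 1 \<Longrightarrow> G t = g_theta \<theta> t"
proof -
  from assms obtain G and c :: "nat \<Rightarrow> real" where k: "1 \<le> k"
    and cont: "continuous_on (cball 0 1 - {1}) G"
    and G: "\<forall>t\<in>ball 0 1. G t = g_theta \<theta> t"
    and ex: "(\<lambda>w. G (exp (- w)) - ((- Ln w) ^ (k + 1) / of_nat (k + 1) + (\<Sum>j=0..k. of_real (c j) * (- Ln w) ^ j)))
             \<in> O[at 0 within {w. 0 \<le> Re w}](\<lambda>w. w)"
    unfolding standing_assumptions_def Let_def by blast
  \<comment> \<open>The sequence \<open>c\<close> is defined on all naturals; its value at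
    \<open>Suc k\<close> is overwritten by the prescribed leading coefficient.\<close>
  define b where "b = (\<lambda>j. if j = Suc k then 1 / real (Suc k) else c j)"
  define p where "p = (\<Sum>j\<le>Suc k. monom (b j) j)"
  have coeff: "coeff p i = (if i \<le> Suc k then b i else 0)" for i
    unfolding p_def by (simp add: coeff_sum sum.delta')
  have deg: "degree p \<le> Suc k" by (intro degree_le) (simp add: coeff)
  have P: "poly (map_poly of_real p) z = z ^ (k + 1) / of_nat (k + 1) + (\<Sum>j=0..k. of_real (c j) * z ^ j)"
    for z :: complex
  proof -
    have "poly (map_poly of_real p) z = (\<Sum>i\<le>Suc k. coeff (map_poly of_real p) i * z ^ i)"
      by (intro poly_eq_sum_atMost degree_le) (simp add: coeff_map_poly coeff)
    also have "\<dots> = (\<Sum>i\<le>k. of_real (c i) * z ^ i) + of_real (1 / real (Suc k)) * z ^ Suc k"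
      by (simp add: coeff_map_poly coeff b_def)
    finally show ?thesis by (simp add: atLeast0AtMost)
  qed
  have "log_singularity p k G"
  proof
    show "coeff p (Suc k) = 1 / real (Suc k)" by (simp add: coeff b_def)
    show "(\<lambda>w. G (exp (- w)) - poly (map_poly of_real p) (- Ln w)) \<in> O[at 0 within {w. 0 \<le> Re w}](\<lambda>w. w)"
      using ex by (simp only: P)
  qed (use k deg cont in auto)
  thus ?thesis using that[of p G] G by blast
qed

lemma cycle_index_eq_g_theta_coeff:
  assumes "standing_assumptions \<theta> k"
  shows "cycle_index (\<lambda>m. u * of_real (\<theta> m)) n = (deriv ^^ n) (\<lambda>z. exp (u * g_theta \<theta> z)) 0 / fact n"
proof (rule cycle_index_eq_coeff)
  have hol: "g_theta \<theta> holomorphic_on ball 0 1"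
    and summ: "\<And>t. t \<in> ball 0 1 \<Longrightarrow> summable (\<lambda>i. complex_of_real (\<theta> (Suc i) / real (Suc i)) * t ^ Suc i)"
    using assms by (auto simp: standing_assumptions_def)
  show "(\<lambda>z. u * g_theta \<theta> z) holomorphic_on ball 0 1" by (intro holomorphic_intros hol)
  define A where "A = Abs_fps (\<lambda>m. if m = 0 then 0 else complex_of_real (\<theta> m / real m))"
  have "g_theta \<theta> has_fps_expansion A"
  proof (rule has_fps_expansionI)
    have "eventually (\<lambda>z::complex. z \<in> ball 0 1) (nhds 0)"
      by (intro eventually_nhds_in_open) auto
    thus "eventually (\<lambda>z. (\<lambda>n. fps_nth A n * z ^ n) sums g_theta \<theta> z) (nhds 0)"
    proof eventually_elim
      case (elim z)
      have "(\<lambda>i. fps_nth A (Suc i) * z ^ Suc i) sums g_theta \<theta> z"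
        using summable_sums[OF summ[OF elim]] by (simp add: A_def g_theta_def)
      hence "(\<lambda>n. fps_nth A n * z ^ n) sums (g_theta \<theta> z + fps_nth A 0 * z ^ 0)"
        by (rule sums_Suc)
      thus ?case by (simp add: A_def)
    qed
  qed
  hence "(\<lambda>z. u * g_theta \<theta> z) has_fps_expansion fps_const u * A"
    by (rule has_fps_expansion_cmult_left)
  also have "fps_const u * A = Abs_fps (\<lambda>m. if m = 0 then 0 else u * of_real (\<theta> m) / of_nat m)"
    by (intro fps_ext) (simp add: A_def)
  finally show "(\<lambda>z. u * g_theta \<theta> z) has_fps_expansion Abs_fps (\<lambda>m. if m = 0 then 0 else u * of_real (\<theta> m) / of_nat m)" .
qed

text \<open>
  Convergence of the two-sided exponential moments alone controls the mean, since
  \<open>1 + s x \<le> exp (s x)\<close> for both signs of \<open>s\<close>.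
\<close>
lemma mean_tendsto_0_of_exponential_moments:
  fixes M :: "nat \<Rightarrow> 'a measure" and X :: "nat \<Rightarrow> 'a \<Rightarrow> real"
  assumes prob: "eventually (\<lambda>n. prob_space (M n)) sequentially"
    and int: "\<And>n. integrable (M n) (X n)" "\<And>n s. integrable (M n) (\<lambda>x. exp (s * X n x))"
    and lim: "\<And>s::real. (\<lambda>n. \<integral>x. exp (s * X n x) \<partial>M n) \<longlonglongrightarrow> exp (s ^ 2 / 2)"
  shows "(\<lambda>n. \<integral>x. X n x \<partial>M n) \<longlonglongrightarrow> 0"
proof (rule tendstoI)
  fix e :: real assume e: "e > 0"
  have key: "1 + s * (\<integral>x. X n x \<partial>M n) \<le> (\<integral>x. exp (s * X n x) \<partial>M n)" if "prob_space (M n)" for n s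
  proof -
    interpret prob_space "M n" by fact
    have "(\<integral>x. 1 + s * X n x \<partial>M n) \<le> (\<integral>x. exp (s * X n x) \<partial>M n)"
      using int by (intro integral_mono) auto
    thus ?thesis using int by (simp add: prob_space)
  qed
  \<comment> \<open>Dividing \<open>1 + s * E X \<le> E exp (s * X)\<close> by \<open>s\<close>
    leaves about \<open>(exp (s^2 / 2) - 1) / s\<close>, which is of order \<open>s\<close>. So
    \<open>s\<close> is fixed first, small in terms of \<open>e\<close>, and \<open>n\<close> grows
    afterwards.\<close>
  have "((\<lambda>s::real. (exp (s ^ 2 / 2) - 1) / s) \<longlongrightarrow> 0) (at_right 0)" by real_asymp
  hence "eventually (\<lambda>s::real. (exp (s ^ 2 / 2) - 1) / s < e) (at_right 0)"
    using e by (rule order_tendstoD)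
  moreover have "eventually (\<lambda>s::real. s > 0) (at_right 0)" by (simp add: eventually_at_right_less)
  ultimately have "eventually (\<lambda>s::real. (exp (s ^ 2 / 2) - 1) / s < e \<and> s > 0) (at_right 0)"
    by eventually_elim auto
  then obtain s :: real where s: "(exp (s ^ 2 / 2) - 1) / s < e" "s > 0"
    using eventually_happens trivial_limit_at_right_real by blast
  have s': "exp (s ^ 2 / 2) < 1 + s * e" using s by (simp add: field_simps)
  have "eventually (\<lambda>n. (\<integral>x. exp (s * X n x) \<partial>M n) < 1 + s * e) sequentially"
    using lim[of s] s' by (rule order_tendstoD)
  moreover have "eventually (\<lambda>n. (\<integral>x. exp ((- s) * X n x) \<partial>M n) < 1 + s * e) sequentially"
    using lim[of "- s"] s' by (intro order_tendstoD) auto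
  ultimately show "eventually (\<lambda>n. dist (\<integral>x. X n x \<partial>M n) 0 < e) sequentially"
    using prob
  proof eventually_elim
    case (elim n)
    have "s * (\<integral>x. X n x \<partial>M n) < s * e" "s * (- (\<integral>x. X n x \<partial>M n)) < s * e"
      using key[OF elim(3), of s] key[OF elim(3), of "- s"] elim by linarith+
    hence "(\<integral>x. X n x \<partial>M n) < e" "- (\<integral>x. X n x \<partial>M n) < e" 
      by (simp_all only: mult_less_cancel_left_pos[OF s(2)])
    thus ?case by (simp add: abs_less_iff)
  qed
qed

theorem theorem3p2:
  fixes \<theta> :: "nat \<Rightarrow> real" and k :: nat
  assumes "standing_assumptions \<theta> k"
  shows "weak_conv_m
           (\<lambda>n. distr (weighted_perm_measure \<theta> n) borel
              (\<lambda>\<sigma>. (real (total_cycles n \<sigma>) - expected_total_cycles \<theta> n)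
                   / sqrt (ln (real n) ^ (k + 1) / real (k + 1))))
           std_normal_distribution
       \<and> expected_total_cycles \<theta> \<sim>[at_top] (\<lambda>n. ln (real n) ^ (k + 1) / real (k + 1))"
proof -
  have nonneg: "\<And>m. 1 \<le> m \<Longrightarrow> 0 \<le> \<theta> m"
    and hol: "g_theta \<theta> holomorphic_on ball 0 1"
    using assms by (auto simp: standing_assumptions_def)
  obtain p G where "log_singularity p k G" and G: "\<And>t. t \<in> ball 0 1 \<Longrightarrow> G t = g_theta \<theta> t"
    using standing_assumptionsE[OF assms] by blast
  interpret log_singularity p k G by fact
  obtain r where r: "filterlim r at_top sequentially"
    "eventually (\<lambda>n. exp (r n) * Q (r n) = real n) sequentially"
    using saddle_points by blast
  define \<sigma> where "\<sigma> = (\<lambda>n. sqrt (ln (real n) ^ (k + 1) / real (k + 1)))"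
  define \<mu> where "\<mu> = (\<lambda>n. poly p (r n))"
  define M where "M = weighted_perm_measure \<theta>"
  define K where "K = (\<lambda>n \<pi>. real (total_cycles n \<pi>))"
  \<comment> \<open>Centred at \<open>\<mu>\<close>, for which the moments are known;
    \<open>m\<close> measures in units of \<open>\<sigma>\<close> how far the true mean is from
    \<open>\<mu>\<close>.\<close>
  define X where "X = (\<lambda>n \<pi>. (K n \<pi> - \<mu> n) / \<sigma> n)"
  define m where "m = (\<lambda>n. \<integral>\<pi>. X n \<pi> \<partial>M n)"
  define a where "a = (\<lambda>v n. (deriv ^^ n) (\<lambda>z. exp (v * g_theta \<theta> z)) 0 / fact n)"
  note moments = exponential_moment_tendsto[OF hol G r]
  have a: "a v n = cycle_index (\<lambda>m. v * of_real (\<theta> m)) n" for v n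
    by (simp add: a_def cycle_index_eq_g_theta_coeff[OF assms])
  have a_ne: "eventually (\<lambda>n. a 1 n \<noteq> 0) sequentially" unfolding a_def by (rule moments(1))
  have sig: "filterlim \<sigma> at_top sequentially" unfolding \<sigma>_def by (rule moments(2))
  have mu: "(\<lambda>n. \<mu> n / \<sigma> n ^ 2) \<longlonglongrightarrow> 1" unfolding \<mu>_def \<sigma>_def by (rule moments(3))
  have sig_pos: "eventually (\<lambda>n. \<sigma> n > 0) sequentially" using sig by (simp add: filterlim_at_top_dense)
  have norm_ne: "eventually (\<lambda>n. weight_norm \<theta> n \<noteq> 0) sequentially"
    using a_ne by eventually_elim (auto simp: a cycle_index_of_real weight_norm_eq_cycle_index)
  have prob: "eventually (\<lambda>n. prob_space (M n)) sequentially"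
    using norm_ne unfolding M_def
    by eventually_elim (intro prob_space_weighted_perm_measure nonneg)
  note int = integrable_weighted_perm_measure[of \<theta>, folded M_def]
  have cexp: "(\<integral>\<pi>. exp (s * of_real (X n \<pi>)) \<partial>M n) =
      a (exp (s / of_real (\<sigma> n))) n / a 1 n * exp (- (s / of_real (\<sigma> n) * of_real (\<mu> n)))" for s :: complex and n
  proof -
    have "exp (s * of_real (X n \<pi>)) = exp (s / of_real (\<sigma> n)) ^ total_cycles n \<pi> * exp (- (s / of_real (\<sigma> n) * of_real (\<mu> n)))" for \<pi>
      by (simp add: X_def K_def diff_divide_distrib ring_distribs exp_diff exp_minus divide_inverse mult_ac flip: exp_of_nat_mult)
    hence "(\<integral>\<pi>. exp (s * of_real (X n \<pi>)) \<partial>M n) =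
      (\<integral>\<pi>. exp (s / of_real (\<sigma> n)) ^ total_cycles n \<pi> \<partial>M n) * exp (- (s / of_real (\<sigma> n) * of_real (\<mu> n)))"
      by simp
    thus ?thesis unfolding M_def by (subst (asm) total_cycles_generating_function[OF nonneg]) (simp_all add: a)
  qed
  have lim: "(\<lambda>n. \<integral>\<pi>. exp (s * of_real (X n \<pi>)) \<partial>M n) \<longlonglongrightarrow> exp (s ^ 2 / 2)" for s :: complex
    unfolding cexp a_def \<sigma>_def \<mu>_def by (rule moments(4))
  have m0: "m \<longlonglongrightarrow> 0"
    unfolding m_def
  proof (rule mean_tendsto_0_of_exponential_moments[OF prob int int])
    fix s :: real
    have "(\<lambda>n. \<integral>\<pi>. exp (of_real s * of_real (X n \<pi>)) \<partial>M n) \<longlonglongrightarrow> (exp (of_real s ^ 2 / 2) :: complex)"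
      by (rule lim)
    also have "(\<lambda>n. \<integral>\<pi>. exp (of_real s * of_real (X n \<pi>)) \<partial>M n) = (\<lambda>n. complex_of_real (\<integral>\<pi>. exp (s * X n \<pi>) \<partial>M n))"
      unfolding integral_complex_of_real[symmetric] by (simp flip: exp_of_real)
    also have "(exp (of_real s ^ 2 / 2) :: complex) = of_real (exp (s ^ 2 / 2))"
      by (simp flip: exp_of_real)
    finally show "(\<lambda>n. \<integral>\<pi>. exp (s * X n \<pi>) \<partial>M n) \<longlonglongrightarrow> exp (s ^ 2 / 2)"
      by (simp only: tendsto_of_real_iff)
  qed
  have mean: "eventually (\<lambda>n. expected_total_cycles \<theta> n = \<mu> n + \<sigma> n * m n) sequentially"
    using prob sig_pos
  proof eventually_elim
    case (elim n)
    interpret prob_space "M n" by fact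
    have "m n = (\<integral>\<pi>. K n \<pi> / \<sigma> n - \<mu> n / \<sigma> n \<partial>M n)"
      by (simp add: m_def X_def diff_divide_distrib)
    also have "\<dots> = (\<integral>\<pi>. K n \<pi> \<partial>M n) / \<sigma> n - \<mu> n / \<sigma> n"
      by (subst Bochner_Integration.integral_diff) (simp_all add: int prob_space)
    finally show ?case using elim by (simp add: expected_total_cycles_def K_def M_def field_simps)
  qed
  have "expected_total_cycles \<theta> \<sim>[at_top] (\<lambda>n. ln (real n) ^ (k + 1) / real (k + 1))"
  proof (rule asymp_equivI')
    \<comment> \<open>The mean divided by \<open>\<sigma>^2\<close>: the correction
      \<open>m / \<sigma>\<close> vanishes.\<close>
    have "(\<lambda>n. \<mu> n / \<sigma> n ^ 2 + m n * inverse (\<sigma> n)) \<longlonglongrightarrow> 1 + 0 * 0"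
      by (intro tendsto_intros mu m0 tendsto_inverse_0_at_top sig)
    moreover have "eventually (\<lambda>n. \<mu> n / \<sigma> n ^ 2 + m n * inverse (\<sigma> n)
        = expected_total_cycles \<theta> n / (ln (real n) ^ (k + 1) / real (k + 1))) sequentially"
      using mean sig_pos eventually_ge_at_top[of 1]
    proof eventually_elim
      case (elim n)
      have sq: "ln (real n) ^ (k + 1) / real (k + 1) = \<sigma> n ^ 2"
        using elim(3) unfolding \<sigma>_def by (subst real_sqrt_pow2) auto
      show ?case unfolding sq elim(1) using elim(2) by (simp add: field_simps power2_eq_square)
    qed
    ultimately show "(\<lambda>n. expected_total_cycles \<theta> n / (ln (real n) ^ (k + 1) / real (k + 1))) \<longlonglongrightarrow> 1"
      by (simp add: tendsto_cong)
  qed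
  moreover have "weak_conv_m (\<lambda>n. distr (M n) borel (\<lambda>\<pi>. (K n \<pi> - expected_total_cycles \<theta> n) / \<sigma> n))
           std_normal_distribution"
  proof -
    define Y where "Y = (\<lambda>n \<pi>. (K n \<pi> - expected_total_cycles \<theta> n) / \<sigma> n)"
    \<comment> \<open>Levy's theorem wants a probability distribution at every index, but for
      finitely many \<open>n\<close> the measure may be zero; the normal law serves as filler
      there.\<close>
    define N where "N = (\<lambda>n. if prob_space (M n) then distr (M n) borel (Y n) else std_normal_distribution)"
    have meas: "f \<in> borel_measurable (M n)" for f :: "(nat \<Rightarrow> nat) \<Rightarrow> real" and n
      using int by (rule borel_measurable_integrable)
    have conv: "weak_conv_m N std_normal_distribution"
    proof (rule levy_continuity)
      show "real_distribution (N n)" for n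
        by (auto simp: N_def real_dist_normal_dist intro: prob_space.real_distribution_distr meas)
      show "real_distribution std_normal_distribution" by (rule real_dist_normal_dist)
      fix t :: real
      \<comment> \<open>Recentring from \<open>\<mu>\<close> to the true mean multiplies the
        characteristic function by \<open>exp (- i * t * m)\<close>, which tends to 1.\<close>
      have "(\<lambda>n. exp (- (\<i> * of_real (t * m n))) * (\<integral>\<pi>. exp ((\<i> * of_real t) * of_real (X n \<pi>)) \<partial>M n))
          \<longlonglongrightarrow> exp (- (\<i> * of_real (t * 0))) * exp ((\<i> * of_real t) ^ 2 / 2)"
        by (intro tendsto_intros m0 lim)
      also have "exp (- (\<i> * of_real (t * 0))) * exp ((\<i> * of_real t) ^ 2 / 2) = char std_normal_distribution t"
        by (simp add: char_std_normal_distribution power_mult_distrib flip: exp_of_real)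
      finally have *: "(\<lambda>n. exp (- (\<i> * of_real (t * m n))) * (\<integral>\<pi>. exp ((\<i> * of_real t) * of_real (X n \<pi>)) \<partial>M n))
          \<longlonglongrightarrow> char std_normal_distribution t" .
      have "eventually (\<lambda>n. exp (- (\<i> * of_real (t * m n))) * (\<integral>\<pi>. exp ((\<i> * of_real t) * of_real (X n \<pi>)) \<partial>M n)
          = char (N n) t) sequentially"
        using prob mean sig_pos
      proof eventually_elim
        case (elim n)
        have Y: "Y n \<pi> = X n \<pi> - m n" for \<pi>
          using elim by (simp add: Y_def X_def field_simps)
        have "char (N n) t = (\<integral>\<pi>. iexp (t * Y n \<pi>) \<partial>M n)"
          using elim unfolding N_def char_def by (simp add: integral_distr meas)
        also have "\<dots> = (\<integral>\<pi>. exp (- (\<i> * of_real (t * m n))) * exp ((\<i> * of_real t) * of_real (X n \<pi>)) \<partial>M n)"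
          by (simp add: Y algebra_simps flip: exp_add)
        finally show ?case by simp
      qed
      with * show "(\<lambda>n. char (N n) t) \<longlonglongrightarrow> char std_normal_distribution t"
        by (rule Lim_transform_eventually)
    qed
    have N: "eventually (\<lambda>n. N n = distr (M n) borel (Y n)) sequentially"
      using prob by eventually_elim (simp add: N_def)
    have "weak_conv_m (\<lambda>n. distr (M n) borel (Y n)) std_normal_distribution"
      unfolding weak_conv_m_def weak_conv_def
    proof (intro allI impI)
      fix x assume "isCont (cdf std_normal_distribution) x"
      with conv have "(\<lambda>n. cdf (N n) x) \<longlonglongrightarrow> cdf std_normal_distribution x"
        by (simp add: weak_conv_m_def weak_conv_def)
      moreover have "eventually (\<lambda>n. cdf (N n) x = cdf (distr (M n) borel (Y n)) x) sequentially"
        using N by eventually_elim simp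
      ultimately show "(\<lambda>n. cdf (distr (M n) borel (Y n)) x) \<longlonglongrightarrow> cdf std_normal_distribution x"
        by (rule Lim_transform_eventually)
    qed
    thus ?thesis by (simp add: Y_def)
  qed
  ultimately show ?thesis by (simp add: M_def K_def \<sigma>_def)
qed

end
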